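(* Let $p\in[1,\infty)$, $q\in(1,\infty)$ and let $b$ be a slowly varying function. Then $$(L^{p,q,b})'=L^{(p',q',b^{-1})}$$ up to equivalence of the defining functionals.
   Context: $(R,\mu)$ is a $\sigma$-finite non-atomic measure space with $\mu(R)=\infty$; $M=M(R,\mu)$ is the set of extended complex-valued $\mu$-measurable functions on $R$ (identified when equal $\mu$-a.e.). For $f\in M$, $f^*(t)=\inf\{s\ge 0:\mu(\{|f|>s\})\le t\}$ and $f^{**}(t)=\frac1t\int_0^t f^*(s)\,ds$. Conventions: $1/\infty=0$; $q'=q/(q-1)$ for $q\in(1,\infty)$, $1'=\infty$, $\infty'=1$; $b^{-1}=1/b$. A measurable $b:(0,\infty)\to(0,\infty)$ is slowly varying if for every $\varepsilon>0$ there are a non-decreasing function $b_\varepsilon$ and a non-increasing function $b_{-\varepsilon}$ with $t^\varepsilon b(t)\approx b_\varepsilon(t)$ and $t^{-\varepsilon}b(t)\approx b_{-\varepsilon}(t)$ on $(0,\infty)$, where $\approx$ denotes two-sided estimate up to positive finite multiplicative constants. For $f\in M$, $\lVert f\rVert_{p,q,b}=\lVert t^{1/p-1/q}b(t)f^*(t)\rVert_q$ and $\lVert f\rVert_{(p,q,b)}=\lVert t^{1/p-1/q}b(t)f^{**}(t)\rVert_q$, where $\lVert\cdot\rVert_q$ is the Lebesgue $L^q$ (quasi)norm over $(0,\infty)$ in the variable $t$; $L^{p,q,b}$ and $L^{(p,q,b)}$ are the sets of $f\in M$ for which the respective functional is finite. The associate space of a space $X=\{f\in M:\lVert f\rVert_X<\infty\}$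 is $X'=\{f\in M:\lVert f\rVert_{X'}<\infty\}$, where $\lVert f\rVert_{X'}=\sup\{\int_R|fg|\,d\mu: g\in M,\ \lVert g\rVert_X\le1\}$. Equality of spaces up to equivalence of the defining functionals means that the sets coincide and the functionals are bounded by constant multiples of each other. *)

theory Defs
  imports "HOL-Probability.Essential_Supremum"
begin

section \<open>Extended complex-valued measurable functions\<close>

datatype ecomplex = Finite complex | Infinite

fun ecmod :: "ecomplex \<Rightarrow> ennreal" where
  "ecmod (Finite z) = ennreal (cmod z)"
| "ecmod Infinite = \<infinity>"

text \<open>The product follows the measure-theoretic convention \<open>0 \<cdot> \<infinity> = 0\<close>.\<close>

fun ectimes :: "ecomplex \<Rightarrow> ecomplex \<Rightarrow> ecomplex" where
  "ectimes (Finite z) (Finite w) = Finite (z * w)"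
| "ectimes Infinite (Finite w) = (if w = 0 then Finite 0 else Infinite)"
| "ectimes (Finite z) Infinite = (if z = 0 then Finite 0 else Infinite)"
| "ectimes Infinite Infinite = Infinite"

text \<open>
  Elements of \<open>M(R, \<mu>)\<close> are represented by functions rather than by classes of functions modulo
  equality almost everywhere; all functionals below are invariant under modification on null sets,
  so the sets of functions obtained are saturated for that relation.
\<close>

definition mfun :: "'a measure \<Rightarrow> ('a \<Rightarrow> ecomplex) set" where
  "mfun R = {f. {x \<in> space R. f x = Infinite} \<in> sets R \<and>
                (\<forall>B \<in> sets borel. {x \<in> space R. f x \<in> Finite ` B} \<in> sets R)}"

definition nonatomic :: "'a measure \<Rightarrow> bool" where
  "nonatomic R \<longleftrightarrow>
     (\<forall>A \<in> sets R. emeasure R A > 0 \<longrightarrow>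
        (\<exists>B \<in> sets R. B \<subseteq> A \<and> 0 < emeasure R B \<and> emeasure R B < emeasure R A))"

section \<open>Rearrangements\<close>

text \<open>The infimum of the empty set is \<open>\<infinity>\<close>.\<close>

definition rearr :: "'a measure \<Rightarrow> ('a \<Rightarrow> ecomplex) \<Rightarrow> real \<Rightarrow> ennreal" where
  "rearr R f t =
     Inf {ennreal s | s. s \<ge> 0 \<and> emeasure R {x \<in> space R. ecmod (f x) > ennreal s} \<le> ennreal t}"

definition max_rearr :: "'a measure \<Rightarrow> ('a \<Rightarrow> ecomplex) \<Rightarrow> real \<Rightarrow> ennreal" where
  "max_rearr R f t = (\<integral>\<^sup>+s\<in>{0<..<t}. rearr R f s \<partial>lborel) / ennreal t"

section \<open>Slowly varying functions\<close>

definition equiv_pos :: "(real \<Rightarrow> real) \<Rightarrow> (real \<Rightarrow> real) \<Rightarrow> bool" where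
  "equiv_pos g h \<longleftrightarrow> (\<exists>c>0. \<exists>C>0. \<forall>t>0. c * h t \<le> g t \<and> g t \<le> C * h t)"

text \<open>Functions on \<open>(0, \<infinity>)\<close> are total functions whose values at \<open>t \<le> 0\<close> are irrelevant.\<close>

definition slowly_varying :: "(real \<Rightarrow> real) \<Rightarrow> bool" where
  "slowly_varying b \<longleftrightarrow>
     b \<in> borel_measurable (lebesgue_on {0<..}) \<and>
     (\<forall>t>0. b t > 0) \<and>
     (\<forall>\<epsilon>>0.
        (\<exists>b1. mono_on {0<..} b1 \<and> equiv_pos (\<lambda>t. t powr \<epsilon> * b t) b1) \<and>
        (\<exists>b2. antimono_on {0<..} b2 \<and> equiv_pos (\<lambda>t. t powr (- \<epsilon>) * b t) b2))"

section \<open>Lorentz--Karamata functionals\<close>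

text \<open>Used for exponents \<open>a > 0\<close> only.\<close>

definition epowr :: "ennreal \<Rightarrow> real \<Rightarrow> ennreal" where
  "epowr x a = (if x = \<infinity> then \<infinity> else ennreal (enn2real x powr a))"

definition Lq_norm :: "ennreal \<Rightarrow> (real \<Rightarrow> ennreal) \<Rightarrow> ennreal" where
  "Lq_norm q h =
     (if q = \<infinity> then esssup (lebesgue_on {0<..}) h
      else epowr (\<integral>\<^sup>+t. epowr (h t) (enn2real q) \<partial>lebesgue_on {0<..}) (1 / enn2real q))"

text \<open>
  Exponents range over \<open>(0, \<infinity>]\<close>; division in \<^typ>\<open>ennreal\<close> satisfies \<open>1 / \<infinity> = 0\<close>.
\<close>

definition LK_weight :: "ennreal \<Rightarrow> ennreal \<Rightarrow> (real \<Rightarrow> real) \<Rightarrow> real \<Rightarrow> ennreal" where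
  "LK_weight p q b t = ennreal (t powr (enn2real (1 / p) - enn2real (1 / q)) * b t)"

definition LK_norm ::
    "'a measure \<Rightarrow> ennreal \<Rightarrow> ennreal \<Rightarrow> (real \<Rightarrow> real) \<Rightarrow> ('a \<Rightarrow> ecomplex) \<Rightarrow> ennreal" where
  "LK_norm R p q b f = Lq_norm q (\<lambda>t. LK_weight p q b t * rearr R f t)"

definition LK_max_norm ::
    "'a measure \<Rightarrow> ennreal \<Rightarrow> ennreal \<Rightarrow> (real \<Rightarrow> real) \<Rightarrow> ('a \<Rightarrow> ecomplex) \<Rightarrow> ennreal" where
  "LK_max_norm R p q b f = Lq_norm q (\<lambda>t. LK_weight p q b t * max_rearr R f t)"

definition conj_exp :: "ennreal \<Rightarrow> ennreal" where
  "conj_exp q = (if q = 1 then \<infinity> else if q = \<infinity> then 1 else q / (q - 1))"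

section \<open>Spaces, associate spaces, and equality up to equivalence\<close>

definition fspace :: "'a measure \<Rightarrow> (('a \<Rightarrow> ecomplex) \<Rightarrow> ennreal) \<Rightarrow> ('a \<Rightarrow> ecomplex) set" where
  "fspace R N = {f \<in> mfun R. N f < \<infinity>}"

definition assoc_norm ::
    "'a measure \<Rightarrow> (('a \<Rightarrow> ecomplex) \<Rightarrow> ennreal) \<Rightarrow> ('a \<Rightarrow> ecomplex) \<Rightarrow> ennreal" where
  "assoc_norm R N f =
     (SUP g\<in>{g \<in> mfun R. N g \<le> 1}. \<integral>\<^sup>+x. ecmod (ectimes (f x) (g x)) \<partial>R)"

definition spaces_equivalent ::
    "'a measure \<Rightarrow> (('a \<Rightarrow> ecomplex) \<Rightarrow> ennreal) \<Rightarrow> (('a \<Rightarrow> ecomplex) \<Rightarrow> ennreal) \<Rightarrow> bool" where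
  "spaces_equivalent R N1 N2 \<longleftrightarrow>
     fspace R N1 = fspace R N2 \<and>
     (\<exists>C::real. C > 0 \<and>
        (\<forall>f \<in> mfun R. N1 f \<le> ennreal C * N2 f \<and> N2 f \<le> ennreal C * N1 f))"

end

theory Submission
  imports Defs
begin

text \<open>
  The associate norm is at most the Lorentz--Karamata norm of \<open>f\<^sup>*\<^sup>*\<close> by the Hardy--Littlewood
  inequality, \<open>f\<^sup>* \<le> f\<^sup>*\<^sup>*\<close> and Hoelder's inequality.

  Conversely, let \<open>\<omega> j = 2\<^bsup>j/p\<^esup> b(2\<^bsup>j\<^esup>)\<close>. Up to constants the \<open>q'\<close>-th power of the norm of \<open>f\<^sup>*\<^sup>*\<close>
  is the sum over \<open>k\<close> of \<open>(S k / \<omega> k)\<^bsup>q'\<^esup>\<close>, where \<open>S k\<close> is the sum of \<open>2\<^bsup>i\<^esup> f\<^sup>*(2\<^bsup>i\<^esup>)\<close> over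
  \<open>i \<le> k\<close>. By non-atomicity \<open>\<bar>f\<bar>\<close> is nearly at least \<open>f\<^sup>*(2\<^bsup>i\<^esup>)\<close> on some set \<open>F i\<close> of measure
  \<open>2\<^bsup>i\<^esup>\<close>. Testing \<open>f\<close> against linear combinations \<open>g\<close> of the indicators of the \<open>F i\<close>
  then recovers the sum by duality. The norm of \<open>g\<close> is controlled by a discrete Hardy inequality,
  which holds because \<open>p < \<infinity>\<close> and slow variation make \<open>\<omega>\<close> grow geometrically.
\<close>

section \<open>Rearrangements and the Hardy--Littlewood inequality\<close>

lemma ecmod_ectimes: "ecmod (ectimes z w) = ecmod z * ecmod w"
  by (cases z; cases w)
     (auto simp: norm_mult ennreal_mult' ennreal_mult_top ennreal_top_mult ennreal_eq_0_iff)

lemma measurable_ecmod: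
  assumes "f \<in> mfun R"
  shows "(\<lambda>x. ecmod (f x)) \<in> borel_measurable R"
proof (rule borel_measurableI_greater)
  fix y :: ennreal
  have [measurable]: "{x \<in> space R. f x = Infinite} \<in> sets R"
    using assms by (auto simp: mfun_def)
  have "{x \<in> space R. f x \<in> Finite ` {z. y < ennreal (cmod z)}} \<in> sets R"
    using assms unfolding mfun_def by (auto simp del: image_iff)
  moreover have "{x \<in> space R. y < ecmod (f x)} =
      {x \<in> space R. f x \<in> Finite ` {z. y < ennreal (cmod z)}} \<union>
      (if y < \<infinity> then {x \<in> space R. f x = Infinite} else {})"
  proof -
    have "y < ecmod w \<longleftrightarrow> w \<in> Finite ` {z. y < ennreal (cmod z)} \<or> y < \<infinity> \<and> w = Infinite" for w
      by (cases w) auto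
    then show ?thesis by auto
  qed
  ultimately show "{x \<in> space R. y < ecmod (f x)} \<in> sets R"
    by (auto split: if_splits)
qed

lemma Finite_in_mfun:
  assumes [measurable]: "h \<in> borel_measurable R"
  shows "(\<lambda>x. Finite (h x)) \<in> mfun R"
proof -
  have "{x \<in> space R. Finite (h x) \<in> Finite ` B} = h -` B \<inter> space R" for B
    by auto
  then show ?thesis
    by (auto simp: mfun_def measurable_sets[OF assms])
qed

text \<open>The superlevel set at \<open>s\<close> is the increasing union of those at
  \<open>s + 1 / real (Suc n)\<close>, so continuity of the measure from below lets the infimum in
  \<open>rearr\<close> be attained. This is the bridge between rearrangements and distribution
  functions.\<close>

lemma rearr_le_iff:
  assumes "f \<in> mfun R" "0 \<le> s"
  shows "rearr R f t \<le> ennreal s \<longleftrightarrow> emeasure R {x \<in> space R. ecmod (f x) > ennreal s} \<le> ennreal t"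
proof
  note [measurable] = measurable_ecmod[OF assms(1)]
  let ?D = "\<lambda>s. {x \<in> space R. ecmod (f x) > ennreal s}"
  show "rearr R f t \<le> ennreal s" if "emeasure R (?D s) \<le> ennreal t"
    unfolding rearr_def using that assms(2) by (intro Inf_lower) auto
  assume le: "rearr R f t \<le> ennreal s"
  have *: "emeasure R (?D (s + 1 / real (Suc n))) \<le> ennreal t" for n
  proof -
    have "rearr R f t < ennreal (s + 1 / real (Suc n))"
      using le by (rule le_less_trans) (use assms in \<open>auto simp: ennreal_less_iff\<close>)
    then obtain u where u: "0 \<le> u" "emeasure R (?D u) \<le> ennreal t"
        "ennreal u < ennreal (s + 1 / real (Suc n))"
      unfolding rearr_def Inf_less_iff by auto
    have "emeasure R (?D (s + 1 / real (Suc n))) \<le> emeasure R (?D u)"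
      using u(3) by (intro emeasure_mono) auto
    then show ?thesis using u(2) by simp
  qed
  have "?D s = (\<Union>n. ?D (s + 1 / real (Suc n)))"
  proof -
    have "\<exists>n. ennreal (s + 1 / real (Suc n)) < y" if y: "ennreal s < y" for y
    proof (cases y)
      case (real r)
      with y assms(2) have "0 < r - s" by (simp add: ennreal_less_iff)
      then obtain n where "1 / real (Suc n) < r - s" using nat_approx_posE by blast
      then show ?thesis using real assms(2) by (intro exI[of _ n]) (simp add: ennreal_less_iff del: ennreal_plus)
    qed auto
    moreover have "ennreal s < y" if "ennreal (s + 1 / real (Suc n)) < y" for y n
      by (rule le_less_trans[OF _ that]) (use assms(2) in \<open>auto intro!: ennreal_leI\<close>)
    ultimately show ?thesis by auto
  qed
  moreover have "incseq (\<lambda>n. ?D (s + 1 / real (Suc n)))"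
  proof (rule incseq_SucI, clarsimp)
    fix n x assume "ennreal (s + 1 / (1 + real n)) < ecmod (f x)"
    then show "ennreal (s + 1 / (2 + real n)) < ecmod (f x)"
      by (rule le_less_trans[rotated]) (auto intro!: ennreal_leI simp: field_simps)
  qed
  ultimately have "emeasure R (?D s) = (SUP n. emeasure R (?D (s + 1 / real (Suc n))))"
    by (subst SUP_emeasure_incseq) auto
  also have "\<dots> \<le> ennreal t" by (intro SUP_least *)
  finally show "emeasure R (?D s) \<le> ennreal t" .
qed

lemma less_rearr_iff:
  assumes "f \<in> mfun R" "0 \<le> s"
  shows "ennreal s < rearr R f t \<longleftrightarrow> ennreal t < emeasure R {x \<in> space R. ecmod (f x) > ennreal s}"
  using rearr_le_iff[OF assms, of t] by (simp add: not_le[symmetric])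

lemma rearr_antimono: "s \<le> t \<Longrightarrow> rearr R f t \<le> rearr R f s"
  unfolding rearr_def by (intro Inf_superset_mono) (blast intro: order_trans ennreal_leI)

lemma borel_measurable_rearr [measurable]:
  assumes "f \<in> mfun R"
  shows "rearr R f \<in> borel_measurable borel"
proof (rule borel_measurableI_greater)
  fix y :: ennreal
  show "{t \<in> space borel. y < rearr R f t} \<in> sets borel"
  proof (cases y)
    case (real r)
    then show ?thesis using less_rearr_iff[OF assms, of r] by simp
  qed auto
qed

section \<open>Layer-cake formula and the Hardy--Littlewood inequality\<close>

lemma emeasure_lborel_greaterThan_0: "emeasure lborel {0::real<..} = top"
proof (cases "emeasure lborel {0::real<..}")
  case (real r)
  have "emeasure lborel {0<..<r + 1} \<le> emeasure lborel {0::real<..}"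
    by (intro emeasure_mono) auto
  with real show ?thesis by (simp add: ennreal_le_iff del: ennreal_plus)
qed simp

text \<open>Each value \<open>H x\<close> is the length of
  \<open>{v. 0 \<le> v \<and> ennreal v < H x}\<close>, and Tonelli's theorem exchanges the
  integrals. The weight \<open>G\<close> allows the formula to be applied to the factors of a
  product one after the other.\<close>

lemma nn_integral_superlevel:
  assumes [measurable]: "G \<in> borel_measurable M" "H \<in> borel_measurable M"
    and "sigma_finite_measure M"
  shows "(\<integral>\<^sup>+x. G x * H x \<partial>M) =
    (\<integral>\<^sup>+v\<in>{0..}. (\<integral>\<^sup>+x. G x * indicator {x. ennreal v < H x} x \<partial>M) \<partial>lborel)"
proof -
  interpret sigma_finite_measure M by fact
  interpret P: pair_sigma_finite M lborel
    by (intro pair_sigma_finite.intro sigma_finite_measure_axioms sigma_finite_lborel)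
  have H: "(\<integral>\<^sup>+v. indicator {v. 0 \<le> v \<and> ennreal v < y} v \<partial>lborel) = y" for y
  proof (cases y)
    case (real r)
    then have "{v. 0 \<le> v \<and> ennreal v < y} = {0..<r}"
      by (auto simp: ennreal_less_iff)
    then show ?thesis using real by simp
  next
    case top
    then have "{0<..} \<subseteq> {v. 0 \<le> v \<and> ennreal v < y}" by (auto simp: ennreal_less_top)
    then have "emeasure lborel {0::real<..} \<le> emeasure lborel {v. 0 \<le> v \<and> ennreal v < y}"
      by (intro emeasure_mono) auto
    then show ?thesis using top by (simp add: emeasure_lborel_greaterThan_0 top_unique)
  qed
  have "(\<integral>\<^sup>+x. G x * H x \<partial>M) =
      (\<integral>\<^sup>+x. \<integral>\<^sup>+v. G x * indicator {v. 0 \<le> v \<and> ennreal v < H x} v \<partial>lborel \<partial>M)"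
    by (subst nn_integral_cmult) (auto simp: H)
  \<comment> \<open>The \<open>if\<close> makes the condition jointly measurable in \<open>x\<close>
    and \<open>v\<close>, as the exchange of integrals requires.\<close>
  also have "\<dots> = (\<integral>\<^sup>+x. \<integral>\<^sup>+v. G x * (if 0 \<le> v \<and> ennreal v < H x then 1 else 0) \<partial>lborel \<partial>M)"
    by (intro nn_integral_cong) (auto simp: indicator_def)
  also have "\<dots> = (\<integral>\<^sup>+v. \<integral>\<^sup>+x. G x * (if 0 \<le> v \<and> ennreal v < H x then 1 else 0) \<partial>M \<partial>lborel)"
    by (rule P.Fubini'[symmetric]) measurable
  also have "\<dots> = (\<integral>\<^sup>+v\<in>{0..}. (\<integral>\<^sup>+x. G x * indicator {x. ennreal v < H x} x \<partial>M) \<partial>lborel)"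
    by (intro nn_integral_cong) (auto simp: indicator_def intro!: nn_integral_cong)
  finally show ?thesis .
qed

text \<open>The layer-cake formula in both factors reduces the claim to superlevel sets. There the
  left side is the measure of an intersection, at most the smaller of the two measures. The right
  side equals that minimum, since the superlevel sets of rearrangements are intervals starting at
  zero.\<close>

theorem hardy_littlewood:
  assumes f: "f \<in> mfun R" and g: "g \<in> mfun R" and R: "sigma_finite_measure R"
  shows "(\<integral>\<^sup>+x. ecmod (f x) * ecmod (g x) \<partial>R) \<le> (\<integral>\<^sup>+t\<in>{0<..}. (rearr R f t * rearr R g t) \<partial>lborel)"
proof -
  note [measurable] = measurable_ecmod[OF f] measurable_ecmod[OF g]
    borel_measurable_rearr[OF f] borel_measurable_rearr[OF g]
  have *: "(\<integral>\<^sup>+x. ecmod (f x) * indicator {x. ennreal v < ecmod (g x)} x \<partial>R) \<le>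
    (\<integral>\<^sup>+t. (rearr R f t * indicator {0<..} t) * indicator {t. ennreal v < rearr R g t} t \<partial>lborel)"
    if v: "v \<ge> 0" for v
  proof -
    have "(\<integral>\<^sup>+x. ecmod (f x) * indicator {x. ennreal v < ecmod (g x)} x \<partial>R) =
       (\<integral>\<^sup>+x. indicator {x. ennreal v < ecmod (g x)} x * ecmod (f x) \<partial>R)"
      by (simp add: mult.commute)
    also have "\<dots> = (\<integral>\<^sup>+u\<in>{0..}. (\<integral>\<^sup>+x. indicator {x. ennreal v < ecmod (g x)} x *
         indicator {x. ennreal u < ecmod (f x)} x \<partial>R) \<partial>lborel)"
      by (intro nn_integral_superlevel R) measurable
    also have "\<dots> \<le> (\<integral>\<^sup>+u\<in>{0..}. (\<integral>\<^sup>+t. (indicator {0<..} t * indicator {t. ennreal v < rearr R g t} t) *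
         indicator {t. ennreal u < rearr R f t} t \<partial>lborel) \<partial>lborel)"
    proof (intro nn_integral_mono, goal_cases)
      case (1 u)
      show ?case
      proof (cases "u \<ge> 0")
        case u: True
        let ?A = "{x \<in> space R. ennreal v < ecmod (g x)}" and ?B = "{x \<in> space R. ennreal u < ecmod (f x)}"
        have AB: "{t \<in> {0<..}. ennreal t < z} = (if z = \<infinity> then {0<..} else {0<..<enn2real z})" for z
          by (cases z) (auto simp: ennreal_less_iff ennreal_less_top)
        have "(\<integral>\<^sup>+x. indicator {x. ennreal v < ecmod (g x)} x * indicator {x. ennreal u < ecmod (f x)} x \<partial>R)
          = (\<integral>\<^sup>+x. indicator (?A \<inter> ?B) x \<partial>R)"
          by (intro nn_integral_cong) (auto simp: indicator_def)
        also have "\<dots> = emeasure R (?A \<inter> ?B)" by (subst nn_integral_indicator) auto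
        also have "\<dots> \<le> min (emeasure R ?A) (emeasure R ?B)"
          by (auto intro!: emeasure_mono)
        also have "\<dots> = emeasure lborel {t \<in> {0<..}. ennreal t < min (emeasure R ?A) (emeasure R ?B)}"
          unfolding AB
          by (cases "min (emeasure R ?A) (emeasure R ?B)") (simp_all add: emeasure_lborel_greaterThan_0)
        \<comment> \<open>By \<open>less_rearr_iff\<close>, lying below both measures means that
          both rearrangements exceed their levels.\<close>
        also have "{t \<in> {0<..}. ennreal t < min (emeasure R ?A) (emeasure R ?B)} =
          {t. 0 < t \<and> ennreal v < rearr R g t \<and> ennreal u < rearr R f t}"
          using u v by (auto simp: less_rearr_iff f g)
        also have "emeasure lborel \<dots> = (\<integral>\<^sup>+t. indicator {t. 0 < t \<and> ennreal v < rearr R g t \<and> ennreal u < rearr R f t} t \<partial>lborel)"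
          by (subst nn_integral_indicator) auto
        also have "\<dots> = (\<integral>\<^sup>+t. (indicator {0<..} t * indicator {t. ennreal v < rearr R g t} t) *
         indicator {t. ennreal u < rearr R f t} t \<partial>lborel)"
          by (intro nn_integral_cong) (auto simp: indicator_def)
        finally show ?thesis using u by simp
      qed auto
    qed
    also have "\<dots> = (\<integral>\<^sup>+t. (indicator {0<..} t * indicator {t. ennreal v < rearr R g t} t) * rearr R f t \<partial>lborel)"
      by (intro nn_integral_superlevel[symmetric] sigma_finite_lborel) measurable
    also have "\<dots> = (\<integral>\<^sup>+t. (rearr R f t * indicator {0<..} t) * indicator {t. ennreal v < rearr R g t} t \<partial>lborel)"
      by (simp add: mult_ac)
    finally show ?thesis .
  qed
  have "(\<integral>\<^sup>+x. ecmod (f x) * ecmod (g x) \<partial>R) =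
    (\<integral>\<^sup>+v\<in>{0..}. (\<integral>\<^sup>+x. ecmod (f x) * indicator {x. ennreal v < ecmod (g x)} x \<partial>R) \<partial>lborel)"
    by (intro nn_integral_superlevel R) measurable
  also have "\<dots> \<le> (\<integral>\<^sup>+v\<in>{0..}. (\<integral>\<^sup>+t. (rearr R f t * indicator {0<..} t) *
      indicator {t. ennreal v < rearr R g t} t \<partial>lborel) \<partial>lborel)"
    using * by (intro nn_integral_mono) (auto simp: indicator_def)
  also have "\<dots> = (\<integral>\<^sup>+t. (rearr R f t * indicator {0<..} t) * rearr R g t \<partial>lborel)"
    by (intro nn_integral_superlevel[symmetric] sigma_finite_lborel) measurable
  finally show ?thesis by (simp add: mult_ac)
qed

lemma rearr_le_max_rearr:
  assumes "t > 0"
  shows "rearr R f t \<le> max_rearr R f t"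
proof -
  have "rearr R f t * ennreal t = (\<integral>\<^sup>+s. rearr R f t * indicator {0<..<t} s \<partial>lborel)"
    using assms by (subst nn_integral_cmult) auto
  also have "\<dots> \<le> (\<integral>\<^sup>+s\<in>{0<..<t}. rearr R f s \<partial>lborel)"
    by (intro nn_integral_mono) (auto simp: indicator_def intro: rearr_antimono)
  finally have "rearr R f t * ennreal t / ennreal t \<le> max_rearr R f t"
    unfolding max_rearr_def by (rule divide_right_mono_ennreal)
  then show ?thesis
    using assms by (simp add: ennreal_mult_divide_eq)
qed

section \<open>Subsets of prescribed measure in non-atomic spaces\<close>

text \<open>Non-atomicity splits a set of finite positive measure into two pieces of positive
  measure, one of which carries at most half of it. Repeated halving drives the measure to
  zero.\<close>

lemma nonatomic_small_subset:
  assumes na: "nonatomic R" and A: "A \<in> sets R" "emeasure R A > 0" and e: "e > 0"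
  obtains B where "B \<in> sets R" "B \<subseteq> A" "0 < emeasure R B" "emeasure R B < ennreal e"
proof -
  obtain B0 where B0: "B0 \<in> sets R" "B0 \<subseteq> A" "0 < emeasure R B0" "emeasure R B0 < emeasure R A"
    using na A unfolding nonatomic_def by blast
  \<comment> \<open>The strict inequality makes the measure of \<open>B0\<close> finite even if that
    of \<open>A\<close> is infinite, so the halving can start.\<close>
  define r where "r = measure R B0"
  have r: "emeasure R B0 = ennreal r"
    unfolding r_def using B0(4) by (intro emeasure_eq_ennreal_measure) auto
  have *: "\<exists>B \<in> sets R. B \<subseteq> A \<and> 0 < emeasure R B \<and> emeasure R B \<le> ennreal (r / 2 ^ n)" for n
  proof (induction n)
    case 0
    then show ?case using B0 r by auto
  next
    case (Suc n)
    then obtain B where B: "B \<in> sets R" "B \<subseteq> A" "0 < emeasure R B" "emeasure R B \<le> ennreal (r / 2 ^ n)"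
      by auto
    then obtain B' where B': "B' \<in> sets R" "B' \<subseteq> B" "0 < emeasure R B'" "emeasure R B' < emeasure R B"
      using na unfolding nonatomic_def by blast
    define x y where "x = measure R B'" and "y = measure R (B - B')"
    have fin: "emeasure R B < \<infinity>" using B(4) by (rule le_less_trans) simp
    have x: "emeasure R B' = ennreal x"
      unfolding x_def using B'(4) by (intro emeasure_eq_ennreal_measure) auto
    have "emeasure R (B - B') \<le> emeasure R B" using B by (intro emeasure_mono) auto
    then have y: "emeasure R (B - B') = ennreal y"
      unfolding y_def using fin by (intro emeasure_eq_ennreal_measure) auto
    have "emeasure R B = emeasure R B' + emeasure R (B - B')"
      using B B' by (subst plus_emeasure) (auto intro!: arg_cong[where f="emeasure R"])
    then have xy: "emeasure R B = ennreal (x + y)" by (simp add: x y x_def y_def)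
    have "r \<ge> 0" by (simp add: r_def)
    then have "x + y \<le> r / 2 ^ n" using B(4) xy by (simp add: x_def y_def del: ennreal_plus)
    have "0 < x" "0 < y"
      using B'(3,4) x xy by (auto simp: x_def y_def ennreal_less_iff simp del: ennreal_plus)
    show ?case
    proof (cases "x \<le> r / 2 ^ Suc n")
      case True
      then show ?thesis using B B' x by (intro bexI[of _ B']) (auto intro: ennreal_leI)
    next
      case False
      then have "y \<le> r / 2 ^ Suc n" using \<open>x + y \<le> r / 2 ^ n\<close> by simp
      then show ?thesis using B B' y \<open>0 < y\<close> by (intro bexI[of _ "B - B'"]) (auto intro: ennreal_leI)
    qed
  qed
  obtain n where n: "r / 2 ^ n < e"
  proof -
    have "(\<lambda>n. r / 2 ^ n) \<longlonglongrightarrow> 0"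
      using LIMSEQ_divide_realpow_zero[of 2 r] by simp
    then have "\<forall>\<^sub>F n in sequentially. r / 2 ^ n < e" using e by (rule order_tendstoD)
    then show ?thesis using that eventually_happens by force
  qed
  obtain B where B: "B \<in> sets R" "B \<subseteq> A" "0 < emeasure R B" "emeasure R B \<le> ennreal (r / 2 ^ n)"
    using * by blast
  moreover have "emeasure R B < ennreal e"
    using B(4) by (rule le_less_trans) (use n e in \<open>auto simp: ennreal_less_iff r_def\<close>)
  ultimately show ?thesis using that by blast
qed

text \<open>Sierpinski's theorem: greedy choices produce a maximal set of measure at most \<open>\<tau>\<close>,
  and non-atomicity rules out that its measure is smaller than \<open>\<tau>\<close>.\<close>

theorem nonatomic_intermediate_value:
  assumes na: "nonatomic R" and A: "A \<in> sets R" and \<tau>: "ennreal \<tau> \<le> emeasure R A"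
  obtains F where "F \<in> sets R" "F \<subseteq> A" "emeasure R F = ennreal \<tau>"
proof -
  define T where "T = {F \<in> sets R. F \<subseteq> A \<and> emeasure R F \<le> ennreal \<tau>}"
  have "\<exists>F. \<forall>n. F n \<in> T \<and> (F n \<subseteq> F (Suc n) \<and>
      (\<forall>G\<in>T. F n \<subseteq> G \<longrightarrow> emeasure R G \<le> emeasure R (F (Suc n)) + ennreal (1 / real (Suc n))))"
  proof (rule dependent_nat_choice)
    show "\<exists>F. F \<in> T" by (rule exI[of _ "{}"]) (auto simp: T_def)
    fix F n assume F: "F \<in> T"
    let ?S = "SUP G\<in>{G \<in> T. F \<subseteq> G}. emeasure R G"
    have "?S \<le> ennreal \<tau>" by (intro SUP_least) (auto simp: T_def)
    then have "?S < \<infinity>" by (rule le_less_trans) simp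
    then have "\<exists>F'\<in>{G \<in> T. F \<subseteq> G}. ?S < emeasure R F' + ennreal (1 / real (Suc n))"
      using F \<open>?S < \<infinity>\<close> by (intro SUP_approx_ennreal) (simp, blast, simp, simp only: infinity_ennreal_def less_top)
    then obtain F' where F': "F' \<in> T" "F \<subseteq> F'" "?S < emeasure R F' + ennreal (1 / real (Suc n))"
      by blast
    have "emeasure R G \<le> emeasure R F' + ennreal (1 / real (Suc n))" if "G \<in> T" "F \<subseteq> G" for G
    proof -
      have "emeasure R G \<le> ?S" using that by (intro SUP_upper) auto
      then show ?thesis using F'(3) by simp
    qed
    then show "\<exists>F'. F' \<in> T \<and> F \<subseteq> F' \<and>
        (\<forall>G\<in>T. F \<subseteq> G \<longrightarrow> emeasure R G \<le> emeasure R F' + ennreal (1 / real (Suc n)))"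
      using F' by blast
  qed
  then obtain F where F: "\<And>n. F n \<in> T" "\<And>n. F n \<subseteq> F (Suc n)"
    and maxF: "\<And>n G. G \<in> T \<Longrightarrow> F n \<subseteq> G \<Longrightarrow> emeasure R G \<le> emeasure R (F (Suc n)) + ennreal (1 / real (Suc n))"
    by blast
  define E where "E = (\<Union>n. F n)"
  have E: "E \<in> sets R" "E \<subseteq> A" using F(1) by (auto simp: E_def T_def)
  have "emeasure R E = (SUP n. emeasure R (F n))"
    unfolding E_def using F by (intro SUP_emeasure_incseq[symmetric] incseq_SucI) (auto simp: T_def)
  also have "\<dots> \<le> ennreal \<tau>" using F(1) by (intro SUP_least) (auto simp: T_def)
  finally have le: "emeasure R E \<le> ennreal \<tau>" .
  have "emeasure R E = ennreal \<tau>"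
  proof (rule ccontr)
    assume "emeasure R E \<noteq> ennreal \<tau>"
    with le have lt: "emeasure R E < ennreal \<tau>" by simp
    then obtain m where m: "emeasure R E = ennreal m" "0 \<le> m"
      by (cases "emeasure R E") auto
    with lt have "m < \<tau>" by (simp add: ennreal_less_iff)
    have "emeasure R A = emeasure R E + emeasure R (A - E)"
      using E A by (subst plus_emeasure) (auto intro!: arg_cong[where f="emeasure R"])
    with lt \<tau> have "emeasure R (A - E) > 0"
      by (metis add.right_neutral leD not_gr_zero)
    then obtain B where B: "B \<in> sets R" "B \<subseteq> A - E" "0 < emeasure R B" "emeasure R B < ennreal (\<tau> - m)"
      using nonatomic_small_subset[OF na, of "A - E" "\<tau> - m"] E A \<open>m < \<tau>\<close> by auto
    then obtain c where c: "emeasure R B = ennreal c" "0 \<le> c" by (cases "emeasure R B") auto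
    with B(3,4) have c': "0 < c" "c < \<tau> - m" by (auto simp: ennreal_less_iff)
    have EB: "emeasure R (E \<union> B) = ennreal (m + c)"
      using B E m c by (subst plus_emeasure[symmetric]) auto
    then have "E \<union> B \<in> T" using E B c' by (auto simp: T_def intro: ennreal_leI)
    \<comment> \<open>\<open>E \<union> B\<close> contains \<open>F n\<close> and hence was a
      candidate at stage \<open>n\<close>. It exceeds \<open>E\<close> by \<open>c\<close>, whereas
      the greedy choice left at most \<open>1 / real (Suc n)\<close> to be gained.\<close>
    obtain n where n: "1 / real (Suc n) < c" using nat_approx_posE c'(1) by blast
    have "ennreal (m + c) \<le> emeasure R (F (Suc n)) + ennreal (1 / real (Suc n))"
      unfolding EB[symmetric] using \<open>E \<union> B \<in> T\<close> by (intro maxF) (auto simp: E_def)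
    also have "\<dots> \<le> emeasure R E + ennreal (1 / real (Suc n))"
      using E F(1) by (intro add_right_mono emeasure_mono) (auto simp: E_def)
    also have "\<dots> = ennreal (m + 1 / real (Suc n))" using m by simp
    also have "\<dots> < ennreal (m + c)" using n m c' by (intro ennreal_lessI) auto
    finally show False by simp
  qed
  then show ?thesis using that E by blast
qed

section \<open>Discrete Hardy inequality\<close>

text \<open>Distinct exponents make the sum a part of the full geometric series. The bound serves
  for both the row sums and the column sums of the kernel
  \<open>\<theta> ^ nat (k - j)\<close>.\<close>

lemma sum_geometric_le:
  fixes \<theta> :: real
  assumes "finite S" "inj_on f S" "0 \<le> \<theta>" "\<theta> < 1"
  shows "(\<Sum>i\<in>S. \<theta> ^ f i) \<le> 1 / (1 - \<theta>)"
proof -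
  have "(\<Sum>i\<in>S. \<theta> ^ f i) = (\<Sum>k\<in>f ` S. \<theta> ^ k)"
    using assms by (simp add: sum.reindex)
  also have "\<dots> \<le> (\<Sum>k. \<theta> ^ k)"
    using assms by (intro sum_le_suminf summable_geometric) auto
  also have "\<dots> = 1 / (1 - \<theta>)" using assms by (intro suminf_geometric) auto
  finally show ?thesis .
qed

text \<open>Jensen's inequality for the convex power, with the weights \<open>u i\<close> normalised
  to total mass one.\<close>

lemma powr_weighted_sum_le:
  fixes u y :: "'b \<Rightarrow> real"
  assumes "finite S" "\<And>i. i \<in> S \<Longrightarrow> 0 \<le> u i" "\<And>i. i \<in> S \<Longrightarrow> 0 \<le> y i" "1 \<le> q"
  shows "(\<Sum>i\<in>S. u i * y i) powr q \<le> (\<Sum>i\<in>S. u i) powr (q - 1) * (\<Sum>i\<in>S. u i * y i powr q)"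
proof -
  \<comment> \<open>Terms outside \<open>T\<close> contribute nothing to either weighted sum of the
    \<open>y i\<close>; without them the normalising mass \<open>W\<close> is positive unless
    \<open>T\<close> is empty.\<close>
  define T where "T = {i \<in> S. 0 < u i \<and> 0 < y i}"
  define W where "W = (\<Sum>i\<in>T. u i)"
  have fT: "finite T" using assms by (simp add: T_def)
  have 1: "(\<Sum>i\<in>S. u i * y i) = (\<Sum>i\<in>T. u i * y i)"
    using assms by (intro sum.mono_neutral_right) (force simp: T_def)+
  have 2: "(\<Sum>i\<in>S. u i * y i powr q) = (\<Sum>i\<in>T. u i * y i powr q)"
    using assms by (intro sum.mono_neutral_right) (force simp: T_def)+
  have 3: "W \<le> (\<Sum>i\<in>S. u i)"
    unfolding W_def using assms by (intro sum_mono2) (auto simp: T_def)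
  show ?thesis
  proof (cases "T = {}")
    case True
    then show ?thesis unfolding 1 2 using assms by simp
  next
    case False
    have W: "W > 0" unfolding W_def using False fT by (intro sum_pos) (auto simp: T_def)
    have "(\<Sum>i\<in>T. (u i / W) *\<^sub>R y i) powr q \<le> (\<Sum>i\<in>T. (u i / W) * y i powr q)"
      using False fT W
      by (intro convex_on_sum[OF _ _ powr_convex[OF assms(4)]])
         (auto simp: T_def W_def simp flip: sum_divide_distrib)
    then have "((\<Sum>i\<in>T. u i * y i) / W) powr q \<le> (\<Sum>i\<in>T. u i * y i powr q) / W"
      by (simp add: sum_divide_distrib)
    moreover have "0 \<le> (\<Sum>i\<in>T. u i * y i)" by (intro sum_nonneg) (auto simp: T_def)
    ultimately have "(\<Sum>i\<in>T. u i * y i) powr q \<le> W powr q * ((\<Sum>i\<in>T. u i * y i powr q) / W)"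
      using W by (simp add: powr_divide field_simps)
    also have "\<dots> = W powr (q - 1) * (\<Sum>i\<in>T. u i * y i powr q)"
      using W by (simp add: powr_diff)
    also have "\<dots> \<le> (\<Sum>i\<in>S. u i) powr (q - 1) * (\<Sum>i\<in>T. u i * y i powr q)"
      using 3 W assms by (intro mult_right_mono powr_mono2 sum_nonneg) (auto simp: T_def)
    finally show ?thesis unfolding 1 2 .
  qed
qed

text \<open>With \<open>x k = w k * a k\<close>, \<open>decay\<close> bounds each weighted tail by a
  sum of the \<open>x k\<close> against a geometric kernel. Jensen's inequality costs a row sum to
  the power \<open>q - 1\<close> and exchanging the summations costs one column sum, each sum being
  at most \<open>1 / (1 - \<theta>)\<close>. The constant is independent of \<open>m\<close> and
  \<open>n\<close>.\<close>

theorem discrete_hardy: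
  fixes w a :: "int \<Rightarrow> real"
  assumes \<theta>: "0 \<le> \<theta>" "\<theta> < 1" and C: "0 < C" and q: "1 \<le> q"
    and w: "\<And>j. 0 < w j" and decay: "\<And>j k. j \<le> k \<Longrightarrow> w j \<le> C * \<theta> ^ nat (k - j) * w k"
    and a: "\<And>k. 0 \<le> a k"
  shows "(\<Sum>j=m..n. (w j * (\<Sum>k=j..n. a k)) powr q) \<le>
    (C / (1 - \<theta>)) powr q * (\<Sum>k=m..n. (w k * a k) powr q)"
proof -
  define x where "x k = w k * a k" for k
  have x: "0 \<le> x k" for k using w a by (simp add: x_def less_imp_le)
  have *: "(w j * (\<Sum>k=j..n. a k)) powr q \<le>
      C powr q * (1 / (1 - \<theta>)) powr (q - 1) * (\<Sum>k=j..n. \<theta> ^ nat (k - j) * x k powr q)" for j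
  proof -
    have "w j * (\<Sum>k=j..n. a k) \<le> C * (\<Sum>k=j..n. \<theta> ^ nat (k - j) * x k)"
      unfolding sum_distrib_left x_def
      using mult_right_mono[OF decay a] by (intro sum_mono) (auto simp: mult_ac)
    then have "(w j * (\<Sum>k=j..n. a k)) powr q \<le> (C * (\<Sum>k=j..n. \<theta> ^ nat (k - j) * x k)) powr q"
      using q a w by (intro powr_mono2 mult_nonneg_nonneg sum_nonneg) (auto simp: less_imp_le)
    also have "\<dots> = C powr q * (\<Sum>k=j..n. \<theta> ^ nat (k - j) * x k) powr q"
      by (rule powr_mult)
    also have "(\<Sum>k=j..n. \<theta> ^ nat (k - j) * x k) powr q \<le>
        (\<Sum>k=j..n. \<theta> ^ nat (k - j)) powr (q - 1) * (\<Sum>k=j..n. \<theta> ^ nat (k - j) * x k powr q)"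
      using \<theta> x q by (intro powr_weighted_sum_le) auto
    also have "\<dots> \<le> (1 / (1 - \<theta>)) powr (q - 1) * (\<Sum>k=j..n. \<theta> ^ nat (k - j) * x k powr q)"
      using \<theta> x q
      by (intro mult_right_mono powr_mono2 sum_geometric_le sum_nonneg) (auto simp: inj_on_def)
    finally show ?thesis using C by (simp add: mult_left_mono mult.assoc)
  qed
  have "(\<Sum>j=m..n. (w j * (\<Sum>k=j..n. a k)) powr q) \<le>
      C powr q * (1 / (1 - \<theta>)) powr (q - 1) * (\<Sum>j=m..n. \<Sum>k=j..n. \<theta> ^ nat (k - j) * x k powr q)"
    unfolding sum_distrib_left[of _ _ "{m..n}"] by (intro sum_mono *)
  also have "(\<Sum>j=m..n. \<Sum>k=j..n. \<theta> ^ nat (k - j) * x k powr q) =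
      (\<Sum>j=m..n. \<Sum>k\<in>{k \<in> {m..n}. j \<le> k}. \<theta> ^ nat (k - j) * x k powr q)"
    by (intro sum.cong) auto
  also have "\<dots> = (\<Sum>k=m..n. \<Sum>j\<in>{j \<in> {m..n}. j \<le> k}. \<theta> ^ nat (k - j) * x k powr q)"
    by (rule sum.swap_restrict) auto
  also have "\<dots> = (\<Sum>k=m..n. (\<Sum>j\<in>{j \<in> {m..n}. j \<le> k}. \<theta> ^ nat (k - j)) * x k powr q)"
    by (simp add: sum_distrib_right)
  also have "\<dots> \<le> (\<Sum>k=m..n. 1 / (1 - \<theta>) * x k powr q)"
  proof (intro sum_mono mult_right_mono sum_geometric_le)
    show "finite {j \<in> {m..n}. j \<le> k}" for k by (rule finite_subset[of _ "{m..n}"]) auto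
  qed (use \<theta> in \<open>auto simp: inj_on_def\<close>)
  also have "\<dots> = 1 / (1 - \<theta>) * (\<Sum>k=m..n. x k powr q)"
    by (simp add: sum_distrib_left)
  also have "C powr q * (1 / (1 - \<theta>)) powr (q - 1) * (1 / (1 - \<theta>) * (\<Sum>k=m..n. x k powr q)) =
      (C / (1 - \<theta>)) powr q * (\<Sum>k=m..n. x k powr q)"
    using C \<theta> by (simp add: powr_divide powr_diff)
  finally show ?thesis using C by (simp add: x_def mult_left_mono)
qed

section \<open>Dyadic integration, slow variation and Hoelder's inequality\<close>

text \<open>The function \<open>h\<close> is arbitrary, so this covers integrands containing
  \<open>b\<close>, which is Lebesgue but perhaps not Borel measurable.\<close>

lemma nn_integral_lebesgue_on_greaterThan:
  "(\<integral>\<^sup>+t. h t \<partial>lebesgue_on {0::real<..}) = (\<integral>\<^sup>+t\<in>{0<..}. h t \<partial>lborel)"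
  by (simp add: nn_integral_restrict_space nn_integral_completion)

text \<open>\<open>h\<close> is majorised by the step function with value \<open>H j\<close> on the
  dyadic interval of length \<open>2 powr j\<close>. Monotone convergence passes from the finite
  symmetric sums to the whole half-line.\<close>

lemma nn_integral_dyadic_le:
  fixes h :: "real \<Rightarrow> ennreal" and H :: "int \<Rightarrow> ennreal"
  assumes le: "\<And>j t. 2 powr j \<le> t \<Longrightarrow> t < 2 powr (j + 1) \<Longrightarrow> h t \<le> H j"
    and C: "\<And>m. (\<Sum>j=-int m..int m. ennreal (2 powr j) * H j) \<le> C"
  shows "(\<integral>\<^sup>+t\<in>{0<..}. h t \<partial>lborel) \<le> C"
proof -
  define I where "I j = {2 powr real_of_int j..<2 powr (real_of_int j + 1)}" for j
  define S where "S m t = (\<Sum>j=-int m..int m. H j * indicator (I j) t)" for m t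
  have [measurable]: "S m \<in> borel_measurable lborel" for m
    unfolding S_def[abs_def] I_def by measurable
  have "incseq S"
    unfolding S_def[abs_def] by (intro incseq_SucI le_funI sum_mono2) auto
  have "h t * indicator {0<..} t \<le> (SUP m. S m t)" for t
  proof (cases "t > 0")
    case True
    define j where "j = \<lfloor>log 2 t\<rfloor>"
    have "real_of_int j \<le> log 2 t" "log 2 t < real_of_int j + 1" unfolding j_def by linarith+
    then have t: "2 powr j \<le> t" "t < 2 powr (j + 1)"
      using True by (simp_all add: powr_le_iff less_powr_iff)
    have "h t * indicator {0<..} t \<le> H j * indicator (I j) t"
      using le[OF t] t by (auto simp: I_def indicator_def)
    also have "\<dots> \<le> S (nat \<bar>j\<bar>) t"
      unfolding S_def by (rule member_le_sum) auto
    also have "\<dots> \<le> (SUP m. S m t)" by (intro SUP_upper) auto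
    finally show ?thesis .
  qed auto
  then have "(\<integral>\<^sup>+t\<in>{0<..}. h t \<partial>lborel) \<le> (\<integral>\<^sup>+t. (SUP m. S m t) \<partial>lborel)"
    by (intro nn_integral_mono)
  also have "\<dots> = (SUP m. \<integral>\<^sup>+t. S m t \<partial>lborel)"
    by (intro nn_integral_monotone_convergence_SUP \<open>incseq S\<close>) measurable
  also have "\<dots> \<le> C"
  proof (intro SUP_least)
    fix m
    have I: "emeasure lborel (I j) = ennreal (2 powr j)" for j
      by (simp add: I_def powr_add)
    have "(\<integral>\<^sup>+t. S m t \<partial>lborel) = (\<Sum>j=-int m..int m. \<integral>\<^sup>+t. H j * indicator (I j) t \<partial>lborel)"
      unfolding S_def by (rule nn_integral_sum) (auto simp: I_def)
    also have "\<dots> = (\<Sum>j=-int m..int m. ennreal (2 powr j) * H j)"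
      by (intro sum.cong refl) (subst nn_integral_cmult_indicator, auto simp: I mult.commute, simp add: I_def)
    finally show "(\<integral>\<^sup>+t. S m t \<partial>lborel) \<le> C" using C[of m] by simp
  qed
  finally show ?thesis .
qed

text \<open>The first bound comes from comparing \<open>t powr \<epsilon> * b t\<close> with the
  non-decreasing \<open>b1\<close>, the second from comparing
  \<open>t powr (- \<epsilon>) * b t\<close> with the non-increasing \<open>b2\<close>.\<close>

lemma slowly_varying_le:
  assumes b: "slowly_varying b" and \<epsilon>: "\<epsilon> > 0"
  obtains C where "C \<ge> 1"
    "\<And>s t. 0 < s \<Longrightarrow> s \<le> t \<Longrightarrow> b s \<le> C * (t / s) powr \<epsilon> * b t"
    "\<And>s t. 0 < s \<Longrightarrow> s \<le> t \<Longrightarrow> b t \<le> C * (t / s) powr \<epsilon> * b s"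
proof -
  have pos: "b t > 0" if "t > 0" for t using b that by (simp add: slowly_varying_def)
  obtain b1 b2 where mono: "mono_on {0<..} b1" "antimono_on {0<..} b2"
    and eq: "equiv_pos (\<lambda>t. t powr \<epsilon> * b t) b1" "equiv_pos (\<lambda>t. t powr (- \<epsilon>) * b t) b2"
    using b \<epsilon> unfolding slowly_varying_def by metis
  obtain c1 C1 where c1: "c1 > 0" "C1 > 0" "\<And>t. t > 0 \<Longrightarrow> c1 * b1 t \<le> t powr \<epsilon> * b t"
      "\<And>t. t > 0 \<Longrightarrow> t powr \<epsilon> * b t \<le> C1 * b1 t"
    using eq(1) unfolding equiv_pos_def by blast
  obtain c2 C2 where c2: "c2 > 0" "C2 > 0" "\<And>t. t > 0 \<Longrightarrow> c2 * b2 t \<le> t powr (-\<epsilon>) * b t"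
      "\<And>t. t > 0 \<Longrightarrow> t powr (-\<epsilon>) * b t \<le> C2 * b2 t"
    using eq(2) unfolding equiv_pos_def by blast
  define C where "C = Max {1, C1 / c1, C2 / c2}"
  have C: "1 \<le> C" "C1 / c1 \<le> C" "C2 / c2 \<le> C" by (auto simp: C_def)
  show thesis
  proof (rule that[OF C(1)])
    fix s t :: real assume st: "0 < s" "s \<le> t"
    have "s powr \<epsilon> * b s \<le> C1 * b1 s" using c1 st by simp
    also have "\<dots> \<le> C1 * b1 t"
      using mono(1) st c1 by (intro mult_left_mono) (auto simp: monotone_on_def)
    also have "\<dots> \<le> (C1 / c1) * (t powr \<epsilon> * b t)" using c1(1,2) c1(3)[of t] st by (simp add: field_simps)
    also have "\<dots> \<le> C * (t powr \<epsilon> * b t)" using C pos[of t] st by (intro mult_right_mono) auto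
    finally show "b s \<le> C * (t / s) powr \<epsilon> * b t" using st by (simp add: powr_divide field_simps)
    have "t powr (-\<epsilon>) * b t \<le> C2 * b2 t" using c2 st by simp
    also have "\<dots> \<le> C2 * b2 s"
      using mono(2) st c2 by (intro mult_left_mono) (auto simp: monotone_on_def)
    also have "\<dots> \<le> (C2 / c2) * (s powr (-\<epsilon>) * b s)" using c2(1,2) c2(3)[of s] st by (simp add: field_simps)
    also have "\<dots> \<le> C * (s powr (-\<epsilon>) * b s)" using C pos[of s] st by (intro mult_right_mono) auto
    finally show "b t \<le> C * (t / s) powr \<epsilon> * b s"
      using st by (simp add: powr_divide powr_minus field_simps)
  qed
qed

section \<open>Powers of extended non-negative numbers and Hoelder's inequality\<close>

lemma epowr_ennreal: "x \<ge> 0 \<Longrightarrow> epowr (ennreal x) a = ennreal (x powr a)"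
  by (simp add: epowr_def)

lemma epowr_mono:
  assumes "x \<le> y" "a > 0"
  shows "epowr x a \<le> epowr y a"
  using assms by (cases x; cases y) (auto simp: epowr_def top_unique intro!: ennreal_leI powr_mono2 split: if_splits)

lemma epowr_le_1_iff:
  assumes "a > 0"
  shows "epowr x a \<le> 1 \<longleftrightarrow> x \<le> 1"
proof (cases x)
  case (real r)
  then have "r powr a \<le> 1 \<longleftrightarrow> r \<le> 1"
    using assms powr_le_cancel_iff by (smt (verit) powr_le1 powr_less_mono2 powr_one_eq_one)
  then show ?thesis using real by (simp add: epowr_ennreal)
qed (simp add: epowr_def)

lemma borel_measurable_epowr [measurable (raw)]:
  assumes [measurable]: "h \<in> borel_measurable M"
  shows "(\<lambda>x. epowr (h x) a) \<in> borel_measurable M"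
  unfolding epowr_def by measurable

text \<open>Young's inequality is applied after dividing \<open>A\<close> by its norm
  \<open>J\<close>; the integrated terms are then at most \<open>J / p\<close> and
  \<open>J / q\<close>. Zero and infinite norms are treated separately.\<close>

lemma nn_integral_Holder:
  assumes pq: "p > 1" "q > 1" "1 / p + 1 / q = 1"
    and [measurable]: "A \<in> borel_measurable M" "B \<in> borel_measurable M"
    and B: "(\<integral>\<^sup>+x. epowr (B x) q \<partial>M) \<le> 1"
  shows "(\<integral>\<^sup>+x. A x * B x \<partial>M) \<le> epowr (\<integral>\<^sup>+x. epowr (A x) p \<partial>M) (1 / p)"
proof (cases "\<integral>\<^sup>+x. epowr (A x) p \<partial>M")
  case top
  then show ?thesis by (simp add: epowr_def)
next
  case (real r)
  show ?thesis
  proof (cases "r = 0")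
    case True
    with real have "(\<integral>\<^sup>+x. epowr (A x) p \<partial>M) = 0" by simp
    then have "AE x in M. epowr (A x) p = 0"
      by (subst (asm) nn_integral_0_iff_AE) auto
    moreover have "A x = 0" if "epowr (A x) p = 0" for x
      using that by (cases "A x") (auto simp: epowr_def split: if_splits)
    ultimately have "(\<integral>\<^sup>+x. A x * B x \<partial>M) = (\<integral>\<^sup>+x. 0 \<partial>M)"
      by (intro nn_integral_cong_AE) auto
    then show ?thesis by simp
  next
    case False
    with real have r: "r > 0" by simp
    define J where "J = r powr (1 / p)"
    have J: "J > 0" "J powr p = r" using r pq by (auto simp: J_def powr_powr)
    \<comment> \<open>Young's inequality for \<open>x / J\<close> and \<open>y\<close>, multiplied
      by \<open>J\<close>; since \<open>J powr p = r\<close>, the first coefficient becomes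
      \<open>J / (r * p)\<close>.\<close>
    have young: "x * y \<le> ennreal (J / (r * p)) * epowr x p + ennreal (J / q) * epowr y q" for x y
    proof (cases x; cases y)
      fix a c assume xy: "x = ennreal a" "0 \<le> a" "y = ennreal c" "0 \<le> c"
      have "(a / J) * c \<le> (a / J) powr p / p + c powr q / q"
        using pq J xy by (intro Youngs_inequality) auto
      then have "J * ((a / J) * c) \<le> J * ((a / J) powr p / p + c powr q / q)"
        using J by (intro mult_left_mono) auto
      then have "a * c \<le> (J / (r * p)) * a powr p + (J / q) * c powr q"
        using J xy by (simp add: powr_divide algebra_simps)
      then show ?thesis
        using xy J r pq by (simp add: epowr_ennreal flip: ennreal_mult' ennreal_plus)
    qed (use J r pq in \<open>auto simp: epowr_def ennreal_mult_top\<close>)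
    have "(\<integral>\<^sup>+x. A x * B x \<partial>M) \<le>
      (\<integral>\<^sup>+x. ennreal (J / (r * p)) * epowr (A x) p + ennreal (J / q) * epowr (B x) q \<partial>M)"
      by (intro nn_integral_mono young)
    also have "\<dots> = ennreal (J / (r * p)) * ennreal r + ennreal (J / q) * (\<integral>\<^sup>+x. epowr (B x) q \<partial>M)"
      by (subst nn_integral_add, measurable) (simp add: nn_integral_cmult real)
    also have "\<dots> \<le> ennreal (J / (r * p)) * ennreal r + ennreal (J / q) * 1"
      by (intro add_left_mono mult_left_mono B) auto
    also have "\<dots> = ennreal (J / p + J / q)"
      using J r pq by (simp flip: ennreal_mult' ennreal_plus)
    also have "J / p + J / q = J * (1 / p + 1 / q)" by (simp add: distrib_left)
    also have "\<dots> = J" using pq by simp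
    finally show ?thesis using real by (simp add: epowr_ennreal J_def)
  qed
qed

section \<open>The upper bound and the discretized weight\<close>

lemma conj_exp_simps:
  assumes "1 < q" "q < \<infinity>"
  shows "conj_exp q = ennreal (enn2real q / (enn2real q - 1))"
    "enn2real q > 1"
proof -
  obtain Q where Q: "q = ennreal Q" "1 < Q"
    using assms by (cases q) (auto simp: ennreal_less_iff simp flip: ennreal_1)
  have "q - 1 = ennreal (Q - 1)"
    using Q by (simp flip: ennreal_1 add: ennreal_minus)
  then show "conj_exp q = ennreal (enn2real q / (enn2real q - 1))" "enn2real q > 1"
    using Q assms by (auto simp: conj_exp_def divide_ennreal)
qed

lemma enn2real_inverse_conj_exp:
  assumes "1 \<le> p" "p < \<infinity>"
  shows "enn2real (1 / p) = 1 / enn2real p" "enn2real (1 / conj_exp p) = 1 - 1 / enn2real p"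
    "enn2real p \<ge> 1"
proof -
  obtain P where P: "p = ennreal P" "1 \<le> P"
    using assms by (cases p) (auto simp: ennreal_le_iff simp flip: ennreal_1)
  have inv: "enn2real (1 / ennreal x) = 1 / x" if "x > 0" for x
    using that by (simp add: divide_ennreal flip: ennreal_1)
  show "enn2real (1 / p) = 1 / enn2real p" "enn2real p \<ge> 1"
    using P by (auto simp: inv)
  show "enn2real (1 / conj_exp p) = 1 - 1 / enn2real p"
  proof (cases "p = 1")
    case True
    then show ?thesis by (simp add: conj_exp_def)
  next
    case False
    then have "1 < p" using assms by simp
    then show ?thesis using conj_exp_simps[of p] assms P
      by (simp add: inv field_simps)
  qed
qed

lemma LK_norm_eq:
  assumes "1 \<le> p" "p < \<infinity>" "1 < q" "q < \<infinity>"
  shows "LK_norm R p q b f =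
    epowr (\<integral>\<^sup>+t\<in>{0<..}. epowr (ennreal (t powr (1 / enn2real p - 1 / enn2real q) * b t) *
      rearr R f t) (enn2real q) \<partial>lborel) (1 / enn2real q)"
proof -
  have "q \<noteq> \<infinity>" using assms(4) by auto
  then show ?thesis
    using assms by (simp add: LK_norm_def Lq_norm_def LK_weight_def
        nn_integral_lebesgue_on_greaterThan enn2real_inverse_conj_exp)
qed

text \<open>The exponent of the weight is 1/p' - 1/q' = (1 - 1/p) - (1 - 1/q) = 1/q - 1/p. The case
  \<open>p = 1\<close> fits because 1/\<infinity> = 0.\<close>

lemma LK_max_norm_conj_eq:
  assumes "1 \<le> p" "p < \<infinity>" "1 < q" "q < \<infinity>"
  defines "q' \<equiv> enn2real q / (enn2real q - 1)"
  shows "LK_max_norm R (conj_exp p) (conj_exp q) (\<lambda>t. 1 / b t) f =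
    epowr (\<integral>\<^sup>+t\<in>{0<..}. epowr (ennreal (t powr (1 / enn2real q - 1 / enn2real p) / b t) *
      max_rearr R f t) q' \<partial>lborel) (1 / q')"
  using assms conj_exp_simps[of q] enn2real_inverse_conj_exp[of q]
  by (simp add: LK_max_norm_def Lq_norm_def LK_weight_def
      nn_integral_lebesgue_on_greaterThan enn2real_inverse_conj_exp)

lemma borel_measurable_lebesgue_onI:
  assumes "h \<in> borel_measurable borel"
  shows "h \<in> borel_measurable (lebesgue_on S)"
  using assms by (intro measurable_restrict_space1 measurable_completion) auto

lemma borel_measurable_max_rearr:
  assumes "f \<in> mfun R"
  shows "max_rearr R f \<in> borel_measurable borel"
proof -
  note [measurable] = borel_measurable_rearr[OF assms]
  \<comment> \<open>Writing the range of integration as a condition on \<open>s\<close> and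
    \<open>t\<close> exposes the joint measurability of the integrand.\<close>
  have "(\<lambda>t. (\<integral>\<^sup>+s. rearr R f s * (if 0 < s \<and> s < t then 1 else 0) \<partial>lborel) / ennreal t)
      \<in> borel_measurable borel"
    by measurable
  then show ?thesis
    by (simp add: max_rearr_def[abs_def] indicator_def of_bool_def)
qed

theorem assoc_norm_le_LK_max_norm:
  assumes R: "sigma_finite_measure R" and pq: "1 \<le> p" "p < \<infinity>" "1 < q" "q < \<infinity>"
    and b: "slowly_varying b" and f: "f \<in> mfun R"
  shows "assoc_norm R (LK_norm R p q b) f \<le>
    LK_max_norm R (conj_exp p) (conj_exp q) (\<lambda>t. 1 / b t) f"
  unfolding assoc_norm_def
proof (intro SUP_least, clarsimp)
  fix g assume g: "g \<in> mfun R" and "LK_norm R p q b g \<le> 1"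
  define P Q where "P = enn2real p" and "Q = enn2real q"
  have Q: "Q > 1" using conj_exp_simps pq by (simp add: Q_def)
  have bpos: "b t > 0" if "t > 0" for t using b that by (simp add: slowly_varying_def)
  define A where "A t = ennreal (t powr (1 / Q - 1 / P) / b t) * max_rearr R f t" for t
  define B where "B t = ennreal (t powr (1 / P - 1 / Q) * b t) * rearr R g t" for t
  have [measurable]: "b \<in> borel_measurable (lebesgue_on {0<..})"
    using b by (simp add: slowly_varying_def)
  have [measurable]: "(\<lambda>t. t powr r) \<in> borel_measurable (lebesgue_on {0<..})" for r :: real
    by (intro borel_measurable_lebesgue_onI) measurable
  note [measurable] = borel_measurable_lebesgue_onI[OF borel_measurable_rearr[OF g]]
    borel_measurable_lebesgue_onI[OF borel_measurable_max_rearr[OF f]]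
  have "LK_norm R p q b g = epowr (\<integral>\<^sup>+t. epowr (B t) Q \<partial>lebesgue_on {0<..}) (1 / Q)"
    using pq by (simp add: LK_norm_eq B_def P_def Q_def nn_integral_lebesgue_on_greaterThan)
  with \<open>LK_norm R p q b g \<le> 1\<close> have B1: "(\<integral>\<^sup>+t. epowr (B t) Q \<partial>lebesgue_on {0<..}) \<le> 1"
    using Q by (simp add: epowr_le_1_iff)
  have "(\<integral>\<^sup>+x. ecmod (ectimes (f x) (g x)) \<partial>R) \<le>
      (\<integral>\<^sup>+t\<in>{0<..}. (rearr R f t * rearr R g t) \<partial>lborel)"
    using hardy_littlewood[OF f g R] by (simp add: ecmod_ectimes)
  also have "\<dots> \<le> (\<integral>\<^sup>+t\<in>{0<..}. (A t * B t) \<partial>lborel)"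
  proof (intro nn_integral_mono, goal_cases)
    case (1 t)
    show ?case
    proof (cases "t > 0")
      case True
      \<comment> \<open>The weights of the two norms are reciprocal, so inserting them leaves the
        product unchanged.\<close>
      have "ennreal (t powr (1 / Q - 1 / P) / b t) * ennreal (t powr (1 / P - 1 / Q) * b t) = 1"
        using True bpos[OF True] by (simp flip: ennreal_mult'' powr_add)
      then have "A t * B t = max_rearr R f t * rearr R g t"
        unfolding A_def B_def by (metis mult.assoc mult.commute mult_1)
      then show ?thesis
        using rearr_le_max_rearr[OF True, of R f] by (simp add: mult_right_mono)
    qed auto
  qed
  \<comment> \<open>Hoelder's inequality is applied over \<open>lebesgue_on\<close>, where
    \<open>b\<close> is measurable.\<close>
  also have "\<dots> = (\<integral>\<^sup>+t. A t * B t \<partial>lebesgue_on {0<..})"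
    by (simp add: nn_integral_lebesgue_on_greaterThan)
  also have "\<dots> \<le> epowr (\<integral>\<^sup>+t. epowr (A t) (Q / (Q - 1)) \<partial>lebesgue_on {0<..}) (1 / (Q / (Q - 1)))"
    using Q B1
    by (intro nn_integral_Holder[where q = Q]) (auto simp: field_simps A_def[abs_def] B_def[abs_def])
  also have "\<dots> = LK_max_norm R (conj_exp p) (conj_exp q) (\<lambda>t. 1 / b t) f"
    using pq by (simp add: LK_max_norm_conj_eq A_def P_def Q_def nn_integral_lebesgue_on_greaterThan)
  finally show "(\<integral>\<^sup>+x. ecmod (ectimes (f x) (g x)) \<partial>R) \<le>
      LK_max_norm R (conj_exp p) (conj_exp q) (\<lambda>t. 1 / b t) f" .
qed

section \<open>The dyadic weight sequence\<close>

lemma powr_le_on_dyadic: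
  fixes s t r :: real
  assumes "0 < s" "s \<le> t" "t \<le> 2 * s"
  shows "t powr r \<le> 2 powr \<bar>r\<bar> * s powr r"
proof -
  have "(t / s) powr r \<le> (t / s) powr \<bar>r\<bar>" using assms by (intro powr_mono) auto
  also have "\<dots> \<le> 2 powr \<bar>r\<bar>" using assms by (intro powr_mono2) (auto simp: field_simps)
  finally show ?thesis using assms by (simp add: powr_divide field_simps)
qed

text \<open>For slowly varying \<open>b\<close> this is, up to constants, the L^Q norm of
  \<open>t powr (1 / P - 1 / Q) * b t\<close> over the interval from \<open>2 powr j\<close> to
  \<open>2 powr (j + 1)\<close>, whatever \<open>Q > 1\<close> is.\<close>

definition dyadic_weight :: "real \<Rightarrow> (real \<Rightarrow> real) \<Rightarrow> int \<Rightarrow> real" where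
  "dyadic_weight P b j = 2 powr (j / P) * b (2 powr j)"

text \<open>Half of the exponent \<open>1 / P\<close> absorbs the variation of \<open>b\<close>; the
  other half gives geometric growth of \<open>\<omega>\<close>. The factor \<open>2 powr j\<close>
  in the last two bounds is the length of the dyadic interval, so these bounds control the integrals
  of the weights over it.\<close>

lemma dyadic_weight_bounds:
  fixes P Q :: real and \<omega> :: "int \<Rightarrow> real"
  assumes b: "slowly_varying b" and P: "P \<ge> 1" and Q: "Q > 1"
  defines "\<omega> \<equiv> dyadic_weight P b" and "Q' \<equiv> Q / (Q - 1)"
  obtains C \<theta> where "C > 0" "0 \<le> \<theta>" "\<theta> < 1" "\<And>j. \<omega> j > 0"
    "\<And>j k. j \<le> k \<Longrightarrow> \<omega> j \<le> C * \<theta> ^ nat (k - j) * \<omega> k"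
    "\<And>j t. 2 powr j \<le> t \<Longrightarrow> t < 2 powr (j + 1) \<Longrightarrow>
       2 powr j * (t powr (1 / P - 1 / Q) * b t) powr Q \<le> C * \<omega> j powr Q"
    "\<And>j t. 2 powr j \<le> t \<Longrightarrow> t < 2 powr (j + 1) \<Longrightarrow>
       2 powr j * (t powr (1 / Q - 1 / P) / b t) powr Q' \<le> C * (2 powr j / \<omega> j) powr Q'"
proof -
  have bpos: "b t > 0" if "t > 0" for t using b that by (simp add: slowly_varying_def)
  define \<epsilon> where "\<epsilon> = 1 / (2 * P)"
  have \<epsilon>: "\<epsilon> > 0" using P by (simp add: \<epsilon>_def)
  obtain D where D: "D \<ge> 1" "\<And>s t. 0 < s \<Longrightarrow> s \<le> t \<Longrightarrow> b s \<le> D * (t / s) powr \<epsilon> * b t"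
    "\<And>s t. 0 < s \<Longrightarrow> s \<le> t \<Longrightarrow> b t \<le> D * (t / s) powr \<epsilon> * b s"
    using slowly_varying_le[OF b \<epsilon>] by metis
  define \<theta> :: real where "\<theta> = 2 powr (-\<epsilon>)"
  \<comment> \<open>Bounds the variation of either weight over one dyadic interval: the first factor
    for the power of \<open>t\<close>, the second for \<open>b\<close>.\<close>
  define E where "E = 2 powr \<bar>1 / P - 1 / Q\<bar> * (D * 2 powr \<epsilon>)"
  define C where "C = Max {D, E powr Q, E powr Q'}"
  have C: "D \<le> C" "E powr Q \<le> C" "E powr Q' \<le> C" by (auto simp: C_def)
  have \<omega>: "\<omega> j > 0" for j by (simp add: \<omega>_def dyadic_weight_def bpos)
  have Q': "Q' > 1" "1 / Q' = 1 - 1 / Q" using Q by (auto simp: Q'_def field_simps)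
  have compare: "b t \<le> D * 2 powr \<epsilon> * b s" "b s \<le> D * 2 powr \<epsilon> * b t"
    if "0 < s" "s \<le> t" "t \<le> 2 * s" for s t
  proof -
    have "(t / s) powr \<epsilon> \<le> 2 powr \<epsilon>" using that \<epsilon> by (intro powr_mono2) (auto simp: field_simps)
    then have *: "D * (t / s) powr \<epsilon> * x \<le> D * 2 powr \<epsilon> * x" if "x > 0" for x
      using that D by (intro mult_right_mono mult_left_mono) auto
    show "b t \<le> D * 2 powr \<epsilon> * b s" using D(3)[of s t] *[of "b s"] bpos[of s] that by simp
    show "b s \<le> D * 2 powr \<epsilon> * b t" using D(2)[of s t] *[of "b t"] bpos[of t] that by simp
  qed
  show thesis
  proof (rule that[of C \<theta>])
    show "C > 0" using C D by linarith
    show "0 \<le> \<theta>" "\<theta> < 1" using \<epsilon> by (auto simp: \<theta>_def powr_less_one)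
    show "\<omega> j > 0" for j by fact
  next
    fix j k :: int assume jk: "j \<le> k"
    have "b (2 powr j) \<le> D * (2 powr k / 2 powr j) powr \<epsilon> * b (2 powr k)"
      using jk by (intro D) auto
    then have "\<omega> j \<le> 2 powr (j / P) * (D * (2 powr k / 2 powr j) powr \<epsilon> * b (2 powr k))"
      unfolding \<omega>_def dyadic_weight_def by (intro mult_left_mono) auto
    also have "2 powr (j / P) * (D * (2 powr k / 2 powr j) powr \<epsilon> * b (2 powr k)) =
        D * (2 powr (j / P) * (2 powr k / 2 powr j) powr \<epsilon>) * b (2 powr k)"
      by (simp add: mult_ac)
    also have "2 powr (j / P) * (2 powr k / 2 powr j) powr \<epsilon> = 2 powr (j / P + (k - j) * \<epsilon>)"
      by (simp add: powr_powr powr_add flip: powr_diff)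
    \<comment> \<open>Since \<open>1 / P = 2 * \<epsilon>\<close>, the loss
      \<open>(k - j) * \<epsilon>\<close> uses up only half of the gain
      \<open>(k - j) / P\<close>.\<close>
    also have "j / P + (k - j) * \<epsilon> = - \<epsilon> * (k - j) + k / P"
      using P by (simp add: \<epsilon>_def field_simps)
    also have "2 powr (- \<epsilon> * (k - j) + k / P) = \<theta> ^ nat (k - j) * 2 powr (k / P)"
      using jk by (subst powr_add) (simp add: \<theta>_def powr_powr flip: powr_realpow)
    also have "D * (\<theta> ^ nat (k - j) * 2 powr (k / P)) * b (2 powr k) = D * \<theta> ^ nat (k - j) * \<omega> k"
      by (simp add: \<omega>_def dyadic_weight_def)
    also have "\<dots> \<le> C * \<theta> ^ nat (k - j) * \<omega> k"
      using C \<omega>[of k] by (intro mult_right_mono) (auto simp: \<theta>_def)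
    finally show "\<omega> j \<le> C * \<theta> ^ nat (k - j) * \<omega> k" .
  next
    fix j :: int and t :: real assume t: "2 powr j \<le> t" "t < 2 powr (j + 1)"
    define s :: real where "s = 2 powr j"
    have s: "0 < s" "s \<le> t" "t \<le> 2 * s" "0 < t"
      using t by (auto simp: s_def powr_add intro: less_le_trans[OF _ t(1)])
    have "t powr (1 / P - 1 / Q) * b t \<le>
        (2 powr \<bar>1 / P - 1 / Q\<bar> * s powr (1 / P - 1 / Q)) * (D * 2 powr \<epsilon> * b s)"
      using s bpos by (intro mult_mono powr_le_on_dyadic compare) (auto simp: less_imp_le)
    also have "\<dots> = E * (s powr (1 / P - 1 / Q) * b s)" by (simp add: E_def mult_ac)
    finally have "(t powr (1 / P - 1 / Q) * b t) powr Q \<le> (E * (s powr (1 / P - 1 / Q) * b s)) powr Q"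
      using Q s bpos by (intro powr_mono2) (auto simp: less_imp_le)
    also have "\<dots> = E powr Q * (s powr ((1 / P - 1 / Q) * Q) * b s powr Q)"
      using s D bpos[of s] by (subst powr_mult, simp_all add: E_def powr_mult powr_powr)
    finally have "s * (t powr (1 / P - 1 / Q) * b t) powr Q \<le>
        s * (E powr Q * (s powr ((1 / P - 1 / Q) * Q) * b s powr Q))"
      using s by (intro mult_left_mono) auto
    also have "\<dots> = E powr Q * ((s powr 1 * s powr ((1 / P - 1 / Q) * Q)) * b s powr Q)"
      using s by (simp add: mult_ac)
    also have "s powr 1 * s powr ((1 / P - 1 / Q) * Q) = s powr (1 / P * Q)"
      using Q s by (simp add: powr_mult_base left_diff_distrib)
    also have "E powr Q * (s powr (1 / P * Q) * b s powr Q) = E powr Q * \<omega> j powr Q"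
      using s bpos[of s] by (simp add: \<omega>_def dyadic_weight_def s_def powr_mult powr_powr)
    also have "\<dots> \<le> C * \<omega> j powr Q" using C by (intro mult_right_mono) auto
    finally show "2 powr j * (t powr (1 / P - 1 / Q) * b t) powr Q \<le> C * \<omega> j powr Q"
      by (simp add: s_def)
  next
    fix j :: int and t :: real assume t: "2 powr j \<le> t" "t < 2 powr (j + 1)"
    define s :: real where "s = 2 powr j"
    have s: "0 < s" "s \<le> t" "t \<le> 2 * s" "0 < t"
      using t by (auto simp: s_def powr_add intro: less_le_trans[OF _ t(1)])
    have "1 / b t \<le> D * 2 powr \<epsilon> * (1 / b s)"
      using compare(2)[of s t] s bpos[of s] bpos[of t] by (simp add: field_simps)
    then have "t powr (1 / Q - 1 / P) * (1 / b t) \<le>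
        (2 powr \<bar>1 / Q - 1 / P\<bar> * s powr (1 / Q - 1 / P)) * (D * 2 powr \<epsilon> * (1 / b s))"
      using s bpos by (intro mult_mono powr_le_on_dyadic) (auto simp: less_imp_le)
    also have "\<dots> = E * (s powr (1 / Q - 1 / P) / b s)"
      by (simp add: E_def mult_ac abs_minus_commute)
    finally have "(t powr (1 / Q - 1 / P) / b t) powr Q' \<le> (E * (s powr (1 / Q - 1 / P) / b s)) powr Q'"
      using Q' s bpos by (intro powr_mono2) (auto simp: less_imp_le)
    also have "\<dots> = E powr Q' * (s powr ((1 / Q - 1 / P) * Q') / b s powr Q')"
      using s D bpos[of s] by (subst powr_mult, simp_all add: E_def powr_divide powr_powr)
    finally have "s * (t powr (1 / Q - 1 / P) / b t) powr Q' \<le>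
        s * (E powr Q' * (s powr ((1 / Q - 1 / P) * Q') / b s powr Q'))"
      using s by (intro mult_left_mono) auto
    also have "\<dots> = E powr Q' * ((s powr 1 * s powr ((1 / Q - 1 / P) * Q')) / b s powr Q')"
      using s by (simp add: mult_ac)
    also have "s powr 1 * s powr ((1 / Q - 1 / P) * Q') = s powr ((1 - 1 / P) * Q')"
    proof -
      \<comment> \<open>The exponent \<open>1\<close> of the interval length equals
        \<open>(1 - 1 / Q) * Q'\<close>, which cancels the term \<open>1 / Q\<close>.\<close>
      have "1 + (1 / Q - 1 / P) * Q' = (1 - 1 / P) * Q'"
        using Q by (simp add: Q'_def field_simps)
      then show ?thesis using s by (simp add: powr_mult_base)
    qed
    also have "E powr Q' * (s powr ((1 - 1 / P) * Q') / b s powr Q') =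
        E powr Q' * ((s / (s powr (1 / P) * b s)) powr Q')"
      using s bpos[of s] by (simp add: powr_mult powr_divide powr_powr powr_diff algebra_simps)
    also have "s powr (1 / P) * b s = \<omega> j"
      by (simp add: \<omega>_def dyadic_weight_def s_def powr_powr)
    also have "E powr Q' * (s / \<omega> j) powr Q' \<le> C * (s / \<omega> j) powr Q'"
      using C by (intro mult_right_mono) auto
    finally show "2 powr j * (t powr (1 / Q - 1 / P) / b t) powr Q' \<le> C * (2 powr j / \<omega> j) powr Q'"
      by (simp add: s_def)
  qed
qed

section \<open>The lower bound\<close>

lemma sum_powr_dyadic_le: "(\<Sum>i=m..<j. 2 powr real_of_int i) \<le> 2 powr real_of_int j"
proof -
  have "2 powr i = 2 powr (j - 1) * (1 / 2) ^ nat (j - 1 - i)" if "i < j" for i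
  proof -
    have "(1 / 2 :: real) ^ nat (j - 1 - i) = 2 powr (- real_of_int (j - 1 - i))"
      unfolding powr_minus using that
      by (simp add: power_one_over inverse_eq_divide flip: powr_realpow)
    then show ?thesis by (simp flip: powr_add)
  qed
  then have "(\<Sum>i=m..<j. 2 powr real_of_int i) = (\<Sum>i=m..<j. 2 powr (j - 1) * (1 / 2) ^ nat (j - 1 - i))"
    by (intro sum.cong) auto
  also have "\<dots> = 2 powr (j - 1) * (\<Sum>i=m..<j. (1 / 2) ^ nat (j - 1 - i))"
    by (rule sum_distrib_left[symmetric])
  also have "\<dots> \<le> 2 powr (j - 1) * (1 / (1 - 1 / 2))"
    by (intro mult_left_mono sum_geometric_le) (auto simp: inj_on_def)
  also have "\<dots> = 2 powr j" by (simp add: powr_diff)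
  finally show ?thesis .
qed

text \<open>The test function is the combination of indicators of sets \<open>F i\<close> with
  coefficients \<open>c i\<close>, where the modulus of \<open>f\<close> is at least
  \<open>s i\<close> on \<open>F i\<close>. \<open>bound\<close> makes its norm at most one, with
  the tails of \<open>c\<close> majorising its rearrangement. All \<open>m\<close> occur because
  this majorant need not vanish near zero, while tails beyond \<open>n\<close> are empty.\<close>

lemma assoc_norm_ge_dyadic_sum:
  fixes c s :: "int \<Rightarrow> real" and n :: nat
  assumes na: "nonatomic R" and pq: "1 \<le> p" "p < \<infinity>" "1 < q" "q < \<infinity>"
    and b: "slowly_varying b" and f: "f \<in> mfun R"
  defines "P \<equiv> enn2real p" and "Q \<equiv> enn2real q"
  assumes C: "C > 0" "\<And>(j::int) t. 2 powr j \<le> t \<Longrightarrow> t < 2 powr (j + 1) \<Longrightarrow>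
       2 powr j * (t powr (1 / P - 1 / Q) * b t) powr Q \<le> C * dyadic_weight P b j powr Q"
    and c: "\<And>k. 0 \<le> c k" and s: "\<And>i. 0 \<le> s i"
    and sf: "\<And>i. s i = 0 \<or> ennreal (s i) < rearr R f (2 powr i)"
    and bound: "\<And>m. (\<Sum>j=-int m..int n. (dyadic_weight P b j * (\<Sum>k=j..int n. c k)) powr Q) \<le> 1 / C"
  shows "ennreal (\<Sum>i=-int n..int n. c i * s i * 2 powr i) \<le> assoc_norm R (LK_norm R p q b) f"
proof -
  note [measurable] = measurable_ecmod[OF f]
  have Q: "Q > 1" using conj_exp_simps pq by (simp add: Q_def)
  have bpos: "b t > 0" if "t > 0" for t using b that by (simp add: slowly_varying_def)
  \<comment> \<open>If \<open>s i\<close> is positive, strictness in \<open>sf\<close> makes the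
    superlevel set larger than \<open>2 powr i\<close>, so it has a subset of exactly that measure.
    If \<open>s i = 0\<close>, the index adds nothing to the claimed sum and the empty set
    suffices.\<close>
  have "\<exists>F. F \<in> sets R \<and> emeasure R F \<le> ennreal (2 powr i) \<and> (\<forall>x\<in>F. ennreal (s i) \<le> ecmod (f x)) \<and>
      (s i = 0 \<or> emeasure R F = ennreal (2 powr i))" for i :: int
  proof (cases "s i = 0")
    case True
    then show ?thesis by (intro exI[of _ "{}"]) auto
  next
    case False
    then have "ennreal (2 powr i) < emeasure R {x \<in> space R. ecmod (f x) > ennreal (s i)}"
      using less_rearr_iff[OF f s] sf by blast
    then obtain F where "F \<in> sets R" "F \<subseteq> {x \<in> space R. ecmod (f x) > ennreal (s i)}"
        "emeasure R F = ennreal (2 powr i)"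
      by (elim nonatomic_intermediate_value[OF na _ less_imp_le, rotated]) auto
    then show ?thesis by (intro exI[of _ F]) auto
  qed
  then obtain F where F [measurable]: "\<And>i. F i \<in> sets R" "\<And>i. emeasure R (F i) \<le> ennreal (2 powr real_of_int i)"
      "\<And>i x. x \<in> F i \<Longrightarrow> ennreal (s i) \<le> ecmod (f x)"
      "\<And>i. s i = 0 \<or> emeasure R (F i) = ennreal (2 powr real_of_int i)"
    by metis
  define h where "h x = (\<Sum>i=-int n..int n. c i * indicator (F i) x)" for x
  define g where "g x = Finite (complex_of_real (h x))" for x
  define G where "G j = (\<Sum>k=j..int n. c k)" for j
  have h0: "h x \<ge> 0" for x unfolding h_def using c by (intro sum_nonneg) auto
  have G0: "G j \<ge> 0" for j unfolding G_def using c by (intro sum_nonneg) auto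
  have g: "g \<in> mfun R"
    unfolding g_def[abs_def] h_def by (intro Finite_in_mfun) measurable
  have g_eq: "ecmod (g x) = ennreal (h x)" for x using h0 by (simp add: g_def)
  \<comment> \<open>The sets \<open>F i\<close> need not be nested: those with \<open>i < j\<close> have total measure at most \<open>2 powr j\<close>,
    and outside them only the coefficients with index at least \<open>j\<close> contribute.\<close>
  have rearr_g: "rearr R g t \<le> ennreal (G j)" if t: "2 powr j \<le> t" for j :: int and t
  proof -
    have "{x \<in> space R. ecmod (g x) > ennreal (G j)} \<subseteq> (\<Union>i\<in>{-int n..<j}. F i)"
    proof (rule subsetI, rule ccontr)
      fix x assume x: "x \<in> {x \<in> space R. ecmod (g x) > ennreal (G j)}" "x \<notin> (\<Union>i\<in>{-int n..<j}. F i)"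
      have "h x = (\<Sum>i\<in>{-int n..int n} \<inter> {j..int n}. c i * indicator (F i) x)"
        unfolding h_def using x(2) by (intro sum.mono_neutral_right) (auto simp: indicator_def)
      also have "\<dots> \<le> (\<Sum>i\<in>{-int n..int n} \<inter> {j..int n}. c i)"
        using c by (intro sum_mono) (auto simp: indicator_def)
      also have "\<dots> \<le> G j"
        unfolding G_def using c by (intro sum_mono2) auto
      finally show False using x(1) G0 by (simp add: g_eq ennreal_less_iff)
    qed
    then have "emeasure R {x \<in> space R. ecmod (g x) > ennreal (G j)} \<le> emeasure R (\<Union>i\<in>{-int n..<j}. F i)"
      by (intro emeasure_mono) auto
    also have "\<dots> \<le> (\<Sum>i=-int n..<j. emeasure R (F i))"
      by (intro emeasure_subadditive_finite) auto
    also have "\<dots> \<le> (\<Sum>i=-int n..<j. ennreal (2 powr i))"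
      by (intro sum_mono F)
    also have "\<dots> = ennreal (\<Sum>i=-int n..<j. 2 powr i)" by simp
    also have "\<dots> \<le> ennreal t" using sum_powr_dyadic_le[of "-int n" j] t by (intro ennreal_leI) linarith
    finally show ?thesis using rearr_le_iff[OF g G0] by blast
  qed
  have "(\<integral>\<^sup>+t\<in>{0<..}. epowr (ennreal (t powr (1 / P - 1 / Q) * b t) * rearr R g t) Q \<partial>lborel) \<le> 1"
  proof (rule nn_integral_dyadic_le)
    fix j :: int and t :: real assume t: "2 powr j \<le> t" "t < 2 powr (j + 1)"
    have tpos: "t > 0" using t(1) by (rule less_le_trans[rotated]) simp
    let ?w = "t powr (1 / P - 1 / Q) * b t"
    have w0: "?w \<ge> 0" using bpos[OF tpos] by simp
    have "epowr (ennreal ?w * rearr R g t) Q \<le> epowr (ennreal ?w * ennreal (G j)) Q"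
      using Q by (intro epowr_mono mult_left_mono rearr_g t) auto
    also have "\<dots> = ennreal (?w powr Q * G j powr Q)"
      using w0 G0 by (simp add: epowr_ennreal powr_mult flip: ennreal_mult)
    \<comment> \<open>The division by \<open>2 powr j\<close> offsets the interval length in
      \<open>nn_integral_dyadic_le\<close>.\<close>
    also have "\<dots> \<le> ennreal (C * dyadic_weight P b j powr Q / 2 powr j * G j powr Q)"
      using C(2)[OF t] by (intro ennreal_leI mult_right_mono) (auto simp: field_simps)
    finally show "epowr (ennreal ?w * rearr R g t) Q \<le>
        ennreal (C * dyadic_weight P b j powr Q / 2 powr j * G j powr Q)" .
  next
    fix m
    have w: "dyadic_weight P b j \<ge> 0" for j using bpos by (simp add: dyadic_weight_def less_imp_le)
    have "(\<Sum>j=-int m..int m. ennreal (2 powr j) * ennreal (C * dyadic_weight P b j powr Q / 2 powr j * G j powr Q))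
      = (\<Sum>j=-int m..int m. ennreal (C * (dyadic_weight P b j * G j) powr Q))"
      using C(1) w G0 by (intro sum.cong refl) (simp add: powr_mult flip: ennreal_mult)
    also have "\<dots> = ennreal (\<Sum>j=-int m..int m. C * (dyadic_weight P b j * G j) powr Q)"
      using C(1) by (intro sum_ennreal) auto
    also have "\<dots> \<le> ennreal 1"
    proof (rule ennreal_leI)
      have "(\<Sum>j=-int m..int m. (dyadic_weight P b j * G j) powr Q) \<le>
          (\<Sum>j\<in>{-int m..int m} \<union> {-int m..int n}. (dyadic_weight P b j * G j) powr Q)"
        by (intro sum_mono2) auto
      \<comment> \<open>For \<open>j > int n\<close> the tail \<open>G j\<close> is an empty
        sum.\<close>
      also have "\<dots> = (\<Sum>j=-int m..int n. (dyadic_weight P b j * G j) powr Q)"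
        by (intro sum.mono_neutral_right) (auto simp: G_def)
      also have "\<dots> \<le> 1 / C" unfolding G_def by (rule bound)
      finally show "(\<Sum>j=-int m..int m. C * (dyadic_weight P b j * G j) powr Q) \<le> 1"
        using C(1) by (simp add: field_simps flip: sum_distrib_left)
    qed
    finally show "(\<Sum>j=-int m..int m. ennreal (2 powr j) *
        ennreal (C * dyadic_weight P b j powr Q / 2 powr j * G j powr Q)) \<le> 1" by simp
  qed
  then have "LK_norm R p q b g \<le> 1"
    using pq Q by (simp add: LK_norm_eq P_def Q_def epowr_le_1_iff)
  then have "(\<integral>\<^sup>+x. ecmod (ectimes (f x) (g x)) \<partial>R) \<le> assoc_norm R (LK_norm R p q b) f"
    unfolding assoc_norm_def using g by (intro SUP_upper) auto
  moreover have "ennreal (\<Sum>i=-int n..int n. c i * s i * 2 powr i) \<le>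
      (\<integral>\<^sup>+x. ecmod (ectimes (f x) (g x)) \<partial>R)"
  proof -
    have "ennreal (\<Sum>i=-int n..int n. c i * s i * 2 powr i) =
        (\<Sum>i=-int n..int n. ennreal (c i * s i) * ennreal (2 powr i))"
      using c s by (simp add: ennreal_mult' sum_ennreal[symmetric])
    also have "\<dots> = (\<Sum>i=-int n..int n. ennreal (c i * s i) * emeasure R (F i))"
    proof (intro sum.cong refl)
      fix i show "ennreal (c i * s i) * ennreal (2 powr i) = ennreal (c i * s i) * emeasure R (F i)"
        using F(4)[of i] by auto
    qed
    also have "\<dots> = (\<Sum>i=-int n..int n. \<integral>\<^sup>+x. ennreal (c i * s i) * indicator (F i) x \<partial>R)"
      by (intro sum.cong refl nn_integral_cmult_indicator[symmetric]) auto
    also have "\<dots> = (\<integral>\<^sup>+x. (\<Sum>i=-int n..int n. ennreal (c i * s i) * indicator (F i) x) \<partial>R)"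
      by (intro nn_integral_sum[symmetric]) measurable
    also have "\<dots> \<le> (\<integral>\<^sup>+x. ecmod (f x) * ecmod (g x) \<partial>R)"
    proof (intro nn_integral_mono)
      fix x
      have "(\<Sum>i=-int n..int n. ennreal (c i * s i) * indicator (F i) x) \<le>
          (\<Sum>i=-int n..int n. ecmod (f x) * ennreal (c i * indicator (F i) x))"
        using F(3) c s
        by (intro sum_mono) (auto simp: indicator_def ennreal_mult' mult.commute[of "ecmod (f x)"] mult_left_mono)
      also have "\<dots> = ecmod (f x) * ecmod (g x)"
        unfolding g_eq h_def using c by (simp add: sum_distrib_left[symmetric] sum_ennreal)
      finally show "(\<Sum>i=-int n..int n. ennreal (c i * s i) * indicator (F i) x) \<le> ecmod (f x) * ecmod (g x)" .
    qed
    finally show ?thesis by (simp add: ecmod_ectimes)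
  qed
  ultimately show ?thesis by simp
qed

text \<open>Duality for the sequence \<open>S k / \<omega> k\<close>: it is tested against \<open>d = (S / \<omega>) powr (Q' - 1)\<close>, so
  that \<open>d powr Q = (S / \<omega>) powr Q'\<close>. Moving the partial sums onto \<open>d / \<omega>\<close> gives the coefficients \<open>c\<close>
  of the test function, and bounding its rearrangement by the tails of \<open>c\<close> costs a second application
  of Hardy's inequality.\<close>

lemma dyadic_partial_sums_le_assoc_norm:
  assumes na: "nonatomic R" and pq: "1 \<le> p" "p < \<infinity>" "1 < q" "q < \<infinity>"
    and b: "slowly_varying b"
  defines "P \<equiv> enn2real p" and "Q \<equiv> enn2real q"
  defines "Q' \<equiv> Q / (Q - 1)"
  obtains K where "K > 0" "\<And>f s (n::nat). f \<in> mfun R \<Longrightarrow> (\<And>i::int. 0 \<le> s i) \<Longrightarrow>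
    (\<And>i. s i = 0 \<or> ennreal (s i) < rearr R f (2 powr i)) \<Longrightarrow>
    ennreal ((\<Sum>k=-int n..int n. ((\<Sum>i=-int n..k. 2 powr i * s i) / dyadic_weight P b k) powr Q') powr (1 / Q')) \<le>
      ennreal K * assoc_norm R (LK_norm R p q b) f"
proof -
  define \<omega> where "\<omega> = dyadic_weight P b"
  have Q: "Q > 1" using conj_exp_simps pq by (simp add: Q_def)
  have P: "P \<ge> 1" using enn2real_inverse_conj_exp pq by (simp add: P_def)
  have Q': "Q' > 1" "(Q' - 1) * Q = Q'" "1 / Q' = 1 - 1 / Q"
    using Q by (auto simp: Q'_def field_simps)
  obtain C \<theta> where C: "C > 0" and \<theta>: "0 \<le> \<theta>" "\<theta> < 1" and \<omega>: "\<And>j. \<omega> j > 0"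
    and decay: "\<And>j k. j \<le> k \<Longrightarrow> \<omega> j \<le> C * \<theta> ^ nat (k - j) * \<omega> k"
    and weight: "\<And>(j::int) t. 2 powr j \<le> t \<Longrightarrow> t < 2 powr (j + 1) \<Longrightarrow>
       2 powr j * (t powr (1 / P - 1 / Q) * b t) powr Q \<le> C * \<omega> j powr Q"
    using dyadic_weight_bounds[OF b P Q] unfolding \<omega>_def by metis
  define L where "L = (C / (1 - \<theta>)) powr Q"
  have L: "L > 0" using C \<theta> by (simp add: L_def)
  \<comment> \<open>\<open>C\<close> is the cost of discretizing the norm of the test function, each
    \<open>L\<close> that of one application of Hardy's inequality.\<close>
  define K where "K = (C * L * L) powr (1 / Q)"
  have K: "K > 0" using C L by (simp add: K_def)
  show thesis
  proof (rule that[OF K])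
    fix f and s :: "int \<Rightarrow> real" and n :: nat
    assume f: "f \<in> mfun R" and s: "\<And>i. 0 \<le> s i"
      and sf: "\<And>i::int. s i = 0 \<or> ennreal (s i) < rearr R f (2 powr i)"
    define S where "S k = (\<Sum>i=-int n..k. 2 powr i * s i)" for k
    define V where "V = (\<Sum>k=-int n..int n. (S k / \<omega> k) powr Q')"
    have S0: "S k \<ge> 0" for k unfolding S_def using s by (intro sum_nonneg) auto
    have V0: "V \<ge> 0" unfolding V_def by (intro sum_nonneg) auto
    define N where "N = assoc_norm R (LK_norm R p q b) f"
    have "ennreal (V powr (1 / Q')) \<le> ennreal K * N"
    proof (cases "V = 0")
      case False
      with V0 have V: "V > 0" by simp
      define d where "d k = (S k / \<omega> k) powr (Q' - 1)" for k
      define a where "a k = (\<Sum>l=k..int n. d l / \<omega> l)" for k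
      \<comment> \<open>Normalises the test function: \<open>M powr Q\<close> is \<open>C\<close>
        times the bound \<open>L * L * V\<close> obtained below for its tails.\<close>
      define M where "M = K * V powr (1 / Q)"
      have M: "M > 0" using K V by (simp add: M_def)
      have MQ: "M powr Q = C * L * L * V"
        using C L V Q by (simp add: M_def K_def powr_mult powr_powr)
      have a0: "a k \<ge> 0" for k
        unfolding a_def using \<omega> by (intro sum_nonneg) (simp add: d_def less_imp_le)
      have hardy: "(\<Sum>j=-int m..int n. (\<omega> j * (\<Sum>k=j..int n. a k)) powr Q) \<le> L * L * V" for m
      proof -
        \<comment> \<open>The first application of Hardy's inequality removes the tail sum of
          \<open>a\<close>, the second the tail sum defining \<open>a\<close>.\<close>
        have "(\<Sum>j=-int m..int n. (\<omega> j * (\<Sum>k=j..int n. a k)) powr Q) \<le>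
            L * (\<Sum>k=-int m..int n. (\<omega> k * a k) powr Q)"
          unfolding L_def using \<theta> C Q \<omega> decay a0 by (intro discrete_hardy) auto
        also have "(\<Sum>k=-int m..int n. (\<omega> k * a k) powr Q) \<le>
            L * (\<Sum>k=-int m..int n. (\<omega> k * (d k / \<omega> k)) powr Q)"
          unfolding L_def a_def using \<theta> C Q \<omega> decay
          by (intro discrete_hardy) (auto simp: d_def less_imp_le)
        also have "(\<Sum>k=-int m..int n. (\<omega> k * (d k / \<omega> k)) powr Q) =
            (\<Sum>k=-int m..int n. (S k / \<omega> k) powr Q')"
        proof (intro sum.cong refl)
          fix k show "(\<omega> k * (d k / \<omega> k)) powr Q = (S k / \<omega> k) powr Q'"
            using \<omega>[of k] Q' by (simp add: d_def powr_powr)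
        qed
        \<comment> \<open>For \<open>k < - int n\<close> the sum \<open>S k\<close> is empty, so the
          indices below the range of \<open>V\<close> contribute zero.\<close>
        also have "\<dots> \<le> (\<Sum>k\<in>{-int m..int n} \<union> {-int n..int n}. (S k / \<omega> k) powr Q')"
          by (intro sum_mono2) auto
        also have "\<dots> = V"
          unfolding V_def by (intro sum.mono_neutral_right) (auto simp: S_def)
        finally show ?thesis using L by (simp add: mult_left_mono mult.assoc)
      qed
      have pair: "(\<Sum>i=-int n..int n. a i * s i * 2 powr i) = V"
      proof -
        have "(\<Sum>i=-int n..int n. a i * s i * 2 powr i) =
            (\<Sum>i=-int n..int n. \<Sum>l\<in>{l \<in> {-int n..int n}. i \<le> l}. d l / \<omega> l * (2 powr i * s i))"
          unfolding a_def sum_distrib_right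
          by (intro sum.cong refl) (auto simp: mult_ac intro!: sum.cong)
        also have "\<dots> = (\<Sum>l=-int n..int n. \<Sum>i\<in>{i \<in> {-int n..int n}. i \<le> l}. d l / \<omega> l * (2 powr i * s i))"
          by (rule sum.swap_restrict) auto
        also have "\<dots> = (\<Sum>l=-int n..int n. d l / \<omega> l * S l)"
          unfolding S_def sum_distrib_left by (intro sum.cong refl) auto
        also have "\<dots> = V"
          unfolding V_def
        proof (intro sum.cong refl)
          fix l
          have "S l / \<omega> l * (S l / \<omega> l) powr (Q' - 1) = (S l / \<omega> l) powr Q'"
            using S0[of l] \<omega>[of l] by (subst powr_mult_base) (auto simp: less_imp_le)
          then show "d l / \<omega> l * S l = (S l / \<omega> l) powr Q'"
            by (simp add: d_def mult.commute)
        qed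
        finally show ?thesis .
      qed
      have "ennreal (\<Sum>i=-int n..int n. a i / M * s i * 2 powr i) \<le> N"
        unfolding N_def
      proof (rule assoc_norm_ge_dyadic_sum[OF na pq b f, of C])
        fix m
        have "(\<Sum>j=-int m..int n. (\<omega> j * (\<Sum>k=j..int n. a k / M)) powr Q) =
            (\<Sum>j=-int m..int n. (\<omega> j * (\<Sum>k=j..int n. a k)) powr Q) / M powr Q"
          unfolding sum_divide_distrib[symmetric] times_divide_eq_right
          using M by (simp add: powr_divide sum_divide_distrib)
        also have "\<dots> \<le> L * L * V / M powr Q" by (intro divide_right_mono hardy) auto
        also have "\<dots> = 1 / C" using C L V by (simp add: MQ)
        finally show "(\<Sum>j=-int m..int n. (dyadic_weight (enn2real p) b j *
            (\<Sum>k=j..int n. a k / M)) powr enn2real q) \<le> 1 / C"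
          by (simp add: \<omega>_def P_def Q_def)
      qed (use C weight a0 M s sf in \<open>auto simp: \<omega>_def P_def Q_def\<close>)
      also have "(\<Sum>i=-int n..int n. a i / M * s i * 2 powr i) = V / M"
        by (simp add: pair[symmetric] sum_divide_distrib)
      \<comment> \<open>\<open>M\<close> carries the factor \<open>V powr (1 / Q)\<close>, and
        \<open>1 - 1 / Q = 1 / Q'\<close>.\<close>
      also have "V / M = V powr (1 / Q') / K"
        using V K by (simp add: M_def Q' powr_diff)
      finally have "ennreal K * ennreal (V powr (1 / Q') / K) \<le> ennreal K * N"
        by (rule mult_left_mono) simp
      then show ?thesis using K by (simp flip: ennreal_mult'')
    qed simp
    then show "ennreal ((\<Sum>k=-int n..int n. ((\<Sum>i=-int n..k. 2 powr i * s i) / dyadic_weight P b k) powr Q') powr (1 / Q')) \<le>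
      ennreal K * assoc_norm R (LK_norm R p q b) f"
      by (simp add: V_def S_def N_def \<omega>_def)
  qed
qed

section \<open>From dyadic partial sums to the norm of the maximal function\<close>

lemma max_rearr_le_dyadic:
  fixes x :: "int \<Rightarrow> real" and k :: int
  assumes x: "\<And>i. 0 \<le> x i" "\<And>i. rearr R f (2 powr i) = ennreal (x i)"
    and S: "\<And>n::nat. (\<Sum>i=-int n..k. 2 powr i * x i) \<le> S"
    and t: "2 powr k \<le> t" "t < 2 powr (k + 1)"
  shows "max_rearr R f t \<le> ennreal (S / 2 powr k)"
proof -
  define g where "g s = rearr R f s * indicator {0<..<t} s" for s
  have "(\<integral>\<^sup>+s\<in>{0<..<t}. rearr R f s \<partial>lborel) = (\<integral>\<^sup>+s\<in>{0<..}. g s \<partial>lborel)"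
    by (intro nn_integral_cong) (auto simp: g_def indicator_def)
  also have "\<dots> \<le> ennreal S"
  proof (rule nn_integral_dyadic_le)
    fix i :: int and s :: real assume s: "2 powr i \<le> s" "s < 2 powr (i + 1)"
    \<comment> \<open>Monotonicity bounds \<open>g\<close> on each dyadic interval by the value of
      the rearrangement at its left endpoint. For \<open>i > k\<close> the integrand vanishes
      because \<open>t < 2 powr (k + 1)\<close>.\<close>
    show "g s \<le> (if i \<le> k then ennreal (x i) else 0)"
    proof (cases "i \<le> k")
      case True
      have "g s \<le> rearr R f s" by (auto simp: g_def indicator_def)
      also have "\<dots> \<le> rearr R f (2 powr i)" using s(1) by (rule rearr_antimono)
      finally show ?thesis using x True by simp
    next
      case False
      then have "2 powr real_of_int (k + 1) \<le> (2 :: real) powr real_of_int i" by (intro powr_mono) auto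
      then have "t < s" using t(2) s(1) by linarith
      then show ?thesis by (simp add: g_def)
    qed
  next
    fix m
    have "(\<Sum>i=-int m..int m. ennreal (2 powr i) * (if i \<le> k then ennreal (x i) else 0)) =
        (\<Sum>i=-int m..int m. ennreal (if i \<le> k then 2 powr i * x i else 0))"
      using x by (intro sum.cong refl) (simp add: ennreal_mult)
    also have "\<dots> = ennreal (\<Sum>i=-int m..int m. if i \<le> k then 2 powr i * x i else 0)"
      using x by (intro sum_ennreal) auto
    also have "(\<Sum>i=-int m..int m. if i \<le> k then 2 powr i * x i else 0) =
        (\<Sum>i\<in>{i \<in> {-int m..int m}. i \<le> k}. 2 powr i * x i)"
      by (intro sum.inter_filter[symmetric]) auto
    also have "\<dots> \<le> (\<Sum>i=-int m..k. 2 powr i * x i)"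
      using x by (intro sum_mono2) auto
    also have "\<dots> \<le> S" by (rule S)
    finally show "(\<Sum>i=-int m..int m. ennreal (2 powr i) * (if i \<le> k then ennreal (x i) else 0)) \<le> ennreal S"
      by (simp add: ennreal_leI)
  qed
  finally have "max_rearr R f t \<le> ennreal S / ennreal t"
    unfolding max_rearr_def by (rule divide_right_mono_ennreal)
  also have "\<dots> = ennreal (S / t)"
  proof (rule divide_ennreal)
    show "0 < t" using t(1) by (rule less_le_trans[rotated]) simp
    show "0 \<le> S" using x S[of 0] by (intro order_trans[OF sum_nonneg S[of 0]]) auto
  qed
  also have "\<dots> \<le> ennreal (S / 2 powr k)"
  proof (intro ennreal_leI divide_left_mono)
    show "0 \<le> S" using x S[of 0] by (intro order_trans[OF sum_nonneg S[of 0]]) auto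
    show "0 < t * 2 powr k" using t(1) by (intro mult_pos_pos less_le_trans[OF _ t(1)]) auto
  qed fact
  finally show ?thesis .
qed

text \<open>The constant in \<open>dyadic_partial_sums_le_assoc_norm\<close> is independent of
  \<open>f\<close>, \<open>s\<close> and \<open>n\<close>, so its bound survives the limit in
  \<open>n\<close>. The tested values are real, hence finiteness of the rearrangement at dyadic
  points is established first.\<close>

theorem LK_max_norm_le_assoc_norm:
  assumes na: "nonatomic R" and pq: "1 \<le> p" "p < \<infinity>" "1 < q" "q < \<infinity>"
    and b: "slowly_varying b"
  obtains K where "K > 0" "\<And>f. f \<in> mfun R \<Longrightarrow>
    LK_max_norm R (conj_exp p) (conj_exp q) (\<lambda>t. 1 / b t) f \<le>
      ennreal K * assoc_norm R (LK_norm R p q b) f"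
proof -
  define P Q where "P = enn2real p" and "Q = enn2real q"
  define Q' where "Q' = Q / (Q - 1)"
  define \<omega> where "\<omega> = dyadic_weight P b"
  have Q: "Q > 1" using conj_exp_simps pq by (simp add: Q_def)
  have P: "P \<ge> 1" using enn2real_inverse_conj_exp pq by (simp add: P_def)
  have Q': "Q' > 1" using Q by (auto simp: Q'_def field_simps)
  have bpos: "b t > 0" if "t > 0" for t using b that by (simp add: slowly_varying_def)
  obtain C where C: "C > 0" and \<omega>: "\<And>j. \<omega> j > 0"
    and weight: "\<And>(j::int) t. 2 powr j \<le> t \<Longrightarrow> t < 2 powr (j + 1) \<Longrightarrow>
       2 powr j * (t powr (1 / Q - 1 / P) / b t) powr Q' \<le> C * (2 powr j / \<omega> j) powr Q'"
    by (rule dyadic_weight_bounds[OF b P Q, folded \<omega>_def Q'_def], rule that)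
  obtain K where K: "K > 0" and main: "\<And>f s (n::nat). f \<in> mfun R \<Longrightarrow> (\<And>i::int. 0 \<le> s i) \<Longrightarrow>
    (\<And>i. s i = 0 \<or> ennreal (s i) < rearr R f (2 powr i)) \<Longrightarrow>
    ennreal ((\<Sum>k=-int n..int n. ((\<Sum>i=-int n..k. 2 powr i * s i) / \<omega> k) powr Q') powr (1 / Q')) \<le>
      ennreal K * assoc_norm R (LK_norm R p q b) f"
    by (rule dyadic_partial_sums_le_assoc_norm[OF na pq b, folded P_def Q_def, folded \<omega>_def Q'_def], rule that, assumption, blast)
  \<comment> \<open>\<open>C\<close> comes from discretizing the weight; the \<open>2\<close> pays
    for testing with half of the rearrangement.\<close>
  define D where "D = C powr (1 / Q') * (2 * K)"
  have D: "D > 0" using C K by (simp add: D_def)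
  show thesis
  proof (rule that[OF D])
    fix f assume f: "f \<in> mfun R"
    define N where "N = assoc_norm R (LK_norm R p q b) f"
    have "LK_max_norm R (conj_exp p) (conj_exp q) (\<lambda>t. 1 / b t) f \<le> ennreal D * N"
    proof (cases N)
      case top
      then show ?thesis using D by (simp add: ennreal_mult_top)
    next
      case (real r)
      have bnd: "(\<Sum>k=-int n..int n. ((\<Sum>i=-int n..k. 2 powr i * s i) / \<omega> k) powr Q') \<le> (K * r) powr Q'"
        if "\<And>i. 0 \<le> s i" "\<And>i. s i = 0 \<or> ennreal (s i) < rearr R f (2 powr i)"
        for s :: "int \<Rightarrow> real" and n :: nat
      proof -
        let ?V = "\<Sum>k=-int n..int n. ((\<Sum>i=-int n..k. 2 powr i * s i) / \<omega> k) powr Q'"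
        have "ennreal (?V powr (1 / Q')) \<le> ennreal (K * r)"
          using main[OF f that, of n] real K by (simp add: N_def ennreal_mult)
        then have "?V powr (1 / Q') \<le> K * r" using K real by (simp add: ennreal_le_iff)
        then have "(?V powr (1 / Q')) powr Q' \<le> (K * r) powr Q'"
          using Q' by (intro powr_mono2) auto
        moreover have "?V \<ge> 0" by (intro sum_nonneg) auto
        ultimately show ?thesis using Q' by (simp add: powr_powr)
      qed
      \<comment> \<open>A single summand of \<open>bnd\<close> already bounds each partial sum with
        index in the summation range.\<close>
      have bnd1: "(\<Sum>i=-int n..k. 2 powr i * s i) \<le> K * r * \<omega> k"
        if s: "\<And>i. 0 \<le> s i" "\<And>i. s i = 0 \<or> ennreal (s i) < rearr R f (2 powr i)" and k: "\<bar>k\<bar> \<le> int n"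
        for s :: "int \<Rightarrow> real" and n :: nat and k
      proof (rule ccontr)
        let ?S = "\<lambda>k. \<Sum>i=-int n..k. 2 powr i * s i"
        assume "\<not> ?S k \<le> K * r * \<omega> k"
        then have "K * r < ?S k / \<omega> k" using \<omega>[of k] by (simp add: field_simps)
        then have "(K * r) powr Q' < (?S k / \<omega> k) powr Q'"
          using K real Q' by (intro powr_less_mono2) auto
        also have "\<dots> \<le> (\<Sum>k=-int n..int n. (?S k / \<omega> k) powr Q')"
          using k by (intro member_le_sum) auto
        finally show False using bnd[OF s, of n] by simp
      qed
      have "rearr R f (2 powr i) < top" for i :: int
      proof (rule ccontr)
        assume "\<not> rearr R f (2 powr i) < top"
        then have top: "rearr R f (2 powr i) = top" by (simp flip: less_top)
        \<comment> \<open>If the rearrangement were infinite at \<open>2 powr i\<close>, every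
          finite spike there would be admissible; this one violates \<open>bnd1\<close> by exactly
          \<open>2 powr i\<close>.\<close>
        define y where "y = K * r * \<omega> i / 2 powr i + 1"
        have y: "y > 0" using K real \<omega>[of i] by (simp add: y_def add_nonneg_pos less_imp_le)
        have "(\<Sum>l=-int (nat \<bar>i\<bar>)..i. 2 powr l * (if l = i then y else 0)) \<le> K * r * \<omega> i"
          using y top by (intro bnd1) auto
        also have "(\<Sum>l=-int (nat \<bar>i\<bar>)..i. 2 powr l * (if l = i then y else 0)) = 2 powr i * y"
          by (subst sum.remove[of _ i]) auto
        finally show False by (simp add: y_def algebra_simps)
      qed
      then have "\<exists>y\<ge>0. rearr R f (2 powr i) = ennreal y" for i :: int
        by (metis ennreal_cases less_irrefl)
      then obtain x :: "int \<Rightarrow> real"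
        where x: "\<And>i. 0 \<le> x i" "\<And>i. rearr R f (2 powr real_of_int i) = ennreal (x i)"
        by metis
      \<comment> \<open>Halving gives the strict inequality that the test sets require, at the price
        of a factor two.\<close>
      have half: "x i / 2 = 0 \<or> ennreal (x i / 2) < rearr R f (2 powr i)" for i
        using x(1)[of i] by (auto simp: x(2) ennreal_less_iff)
      define S where "S n k = (\<Sum>i=-int n..k. 2 powr i * x i)" for n k
      have S2: "(\<Sum>i=-int n..k. 2 powr i * (x i / 2)) = S n k / 2" for n k
        by (simp add: S_def sum_divide_distrib)
      have S0: "0 \<le> S n k" for n k
        unfolding S_def using x by (intro sum_nonneg) auto
      have incS: "incseq (\<lambda>n. S n k)" for k
        unfolding S_def using x by (intro incseq_SucI sum_mono2) auto
      have "\<exists>s. (\<lambda>n. S n k) \<longlonglongrightarrow> s \<and> (\<forall>n. S n k \<le> s)" for k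
      proof -
        have "S n k \<le> 2 * (K * r * \<omega> k)" for n
        proof -
          \<comment> \<open>Enlarging \<open>n\<close> brings \<open>k\<close> into the range where
            \<open>bnd1\<close> applies.\<close>
          have "S n k \<le> S (max n (nat \<bar>k\<bar>)) k" using incS[of k] by (auto simp: incseq_def)
          also have "S (max n (nat \<bar>k\<bar>)) k / 2 \<le> K * r * \<omega> k"
            unfolding S2[symmetric] using x half by (intro bnd1) auto
          then have "S (max n (nat \<bar>k\<bar>)) k \<le> 2 * (K * r * \<omega> k)" by simp
          finally show ?thesis .
        qed
        then show ?thesis using incseq_convergent[OF incS] by metis
      qed
      then obtain s where lim: "\<And>k. (\<lambda>n. S n k) \<longlonglongrightarrow> s k" and S_le: "\<And>n k. S n k \<le> s k"
        by metis
      have s0: "s k \<ge> 0" for k using S0 S_le order_trans by blast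
      \<comment> \<open>The outer range \<open>m\<close> stays fixed while the lower end of the
        inner sums tends to minus infinity; \<open>bnd\<close> applies as soon as
        \<open>m \<le> n\<close>.\<close>
      have sum_s: "(\<Sum>k=-int m..int m. (s k / \<omega> k) powr Q') \<le> (2 * K * r) powr Q'" for m
      proof (rule LIMSEQ_le_const2)
        show "(\<lambda>n. \<Sum>k=-int m..int m. (S n k / \<omega> k) powr Q') \<longlonglongrightarrow> (\<Sum>k=-int m..int m. (s k / \<omega> k) powr Q')"
          using S0 \<omega> Q'
          by (intro tendsto_sum tendsto_powr' tendsto_divide lim tendsto_const)
             (auto simp: less_imp_le less_imp_neq[OF \<omega>, symmetric] intro!: always_eventually)
        have "(\<Sum>k=-int m..int m. (S n k / \<omega> k) powr Q') \<le> (2 * K * r) powr Q'" if "m \<le> n" for n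
        proof -
          have "(\<Sum>k=-int m..int m. (S n k / \<omega> k) powr Q') \<le> (\<Sum>k=-int n..int n. (S n k / \<omega> k) powr Q')"
            using that by (intro sum_mono2) auto
          also have "\<dots> = 2 powr Q' * (\<Sum>k=-int n..int n. (S n k / 2 / \<omega> k) powr Q')"
          proof -
            have "(S n k / \<omega> k) powr Q' = 2 powr Q' * (S n k / 2 / \<omega> k) powr Q'" for k
              by (simp flip: powr_mult)
            then show ?thesis by (simp add: sum_distrib_left)
          qed
          also have "\<dots> \<le> 2 powr Q' * (K * r) powr Q'"
            unfolding S2[symmetric] using x half by (intro mult_left_mono bnd) auto
          finally show ?thesis by (simp add: mult.assoc flip: powr_mult)
        qed
        then show "\<exists>N. \<forall>n\<ge>N. (\<Sum>k=-int m..int m. (S n k / \<omega> k) powr Q') \<le> (2 * K * r) powr Q'"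
          by blast
      qed
      have "(\<integral>\<^sup>+t\<in>{0<..}. epowr (ennreal (t powr (1 / Q - 1 / P) / b t) * max_rearr R f t) Q' \<partial>lborel)
          \<le> ennreal (C * (2 * K * r) powr Q')"
      proof (rule nn_integral_dyadic_le)
        fix j :: int and t :: real assume t: "2 powr j \<le> t" "t < 2 powr (j + 1)"
        have tpos: "t > 0" using t(1) by (rule less_le_trans[rotated]) simp
        let ?w = "t powr (1 / Q - 1 / P) / b t"
        have w0: "?w \<ge> 0" using bpos[OF tpos] by simp
        have "epowr (ennreal ?w * max_rearr R f t) Q' \<le> epowr (ennreal ?w * ennreal (s j / 2 powr j)) Q'"
          using Q' x S_le t
          by (intro epowr_mono mult_left_mono max_rearr_le_dyadic) (auto simp: S_def)
        also have "\<dots> = ennreal ((?w * (s j / 2 powr j)) powr Q')"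
          using w0 s0[of j]
          by (subst ennreal_mult[symmetric], simp, simp) (rule epowr_ennreal, rule mult_nonneg_nonneg, auto)
        also have "\<dots> = ennreal (?w powr Q' * (s j / 2 powr j) powr Q')"
          by (simp only: powr_mult)
        also have "\<dots> \<le> ennreal (C * (2 powr j / \<omega> j) powr Q' / 2 powr j * (s j / 2 powr j) powr Q')"
          using weight[OF t] by (intro ennreal_leI mult_right_mono) (auto simp: field_simps)
        also have "C * (2 powr j / \<omega> j) powr Q' / 2 powr j * (s j / 2 powr j) powr Q' =
            C * ((2 powr j / \<omega> j) powr Q' * (s j / 2 powr j) powr Q') / 2 powr j"
          by simp
        \<comment> \<open>The averaging factor \<open>1 / 2 powr j\<close> from
          \<open>max_rearr_le_dyadic\<close> cancels the numerator of the discretized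
          weight.\<close>
        also have "(2 powr j / \<omega> j) powr Q' * (s j / 2 powr j) powr Q' = (s j / \<omega> j) powr Q'"
          by (simp flip: powr_mult)
        finally show "epowr (ennreal ?w * max_rearr R f t) Q' \<le> ennreal (C * (s j / \<omega> j) powr Q' / 2 powr j)" .
      next
        fix m
        have "(\<Sum>j=-int m..int m. ennreal (2 powr j) * ennreal (C * (s j / \<omega> j) powr Q' / 2 powr j)) =
            (\<Sum>j=-int m..int m. ennreal (C * (s j / \<omega> j) powr Q'))"
          using C by (intro sum.cong refl) (simp flip: ennreal_mult)
        also have "\<dots> = ennreal (\<Sum>j=-int m..int m. C * (s j / \<omega> j) powr Q')"
          using C by (intro sum_ennreal) auto
        also have "\<dots> \<le> ennreal (C * (2 * K * r) powr Q')"
          using C sum_s[of m] by (intro ennreal_leI) (simp flip: sum_distrib_left)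
        finally show "(\<Sum>j=-int m..int m. ennreal (2 powr j) * ennreal (C * (s j / \<omega> j) powr Q' / 2 powr j))
            \<le> ennreal (C * (2 * K * r) powr Q')" .
      qed
      then have "LK_max_norm R (conj_exp p) (conj_exp q) (\<lambda>t. 1 / b t) f \<le>
          epowr (ennreal (C * (2 * K * r) powr Q')) (1 / Q')"
        unfolding LK_max_norm_conj_eq[OF pq] P_def[symmetric] Q_def[symmetric] Q'_def[symmetric]
        using Q' by (intro epowr_mono) auto
      also have "\<dots> = ennreal ((C * (2 * K * r) powr Q') powr (1 / Q'))"
        using C by (simp add: epowr_ennreal)
      also have "(C * (2 * K * r) powr Q') powr (1 / Q') = D * r"
        using K real Q' by (simp add: D_def powr_mult powr_powr)
      also have "ennreal (D * r) = ennreal D * N"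
        using D real by (simp add: ennreal_mult)
      finally show ?thesis .
    qed
    then show "LK_max_norm R (conj_exp p) (conj_exp q) (\<lambda>t. 1 / b t) f \<le>
        ennreal D * assoc_norm R (LK_norm R p q b) f" by (simp add: N_def)
  qed
qed

theorem theorem3p28:
  fixes R :: "'a measure" and p q :: ennreal and b :: "real \<Rightarrow> real"
  assumes "sigma_finite_measure R"
    and "nonatomic R"
    and "emeasure R (space R) = \<infinity>"
    and "1 \<le> p" and "p < \<infinity>"
    and "1 < q" and "q < \<infinity>"
    and "slowly_varying b"
  shows "spaces_equivalent R
           (assoc_norm R (LK_norm R p q b))
           (LK_max_norm R (conj_exp p) (conj_exp q) (\<lambda>t. 1 / b t))"
proof -
  let ?N1 = "assoc_norm R (LK_norm R p q b)"
  let ?N2 = "LK_max_norm R (conj_exp p) (conj_exp q) (\<lambda>t. 1 / b t)"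
  obtain K where K: "K > 0" "\<And>f. f \<in> mfun R \<Longrightarrow> ?N2 f \<le> ennreal K * ?N1 f"
    using LK_max_norm_le_assoc_norm assms by metis
  have le: "?N1 f \<le> ?N2 f" if "f \<in> mfun R" for f
    using assms that by (intro assoc_norm_le_LK_max_norm)
  have "?N1 f < \<infinity> \<longleftrightarrow> ?N2 f < \<infinity>" if f: "f \<in> mfun R" for f
  proof
    assume "?N1 f < \<infinity>"
    then have "ennreal K * ?N1 f < \<infinity>" by (simp add: ennreal_mult_less_top)
    with K(2)[OF f] show "?N2 f < \<infinity>" by (rule le_less_trans)
  qed (use le[OF f] in \<open>rule le_less_trans\<close>)
  \<comment> \<open>One constant must serve both directions: \<open>1\<close> suffices for the first
    inequality and \<open>K\<close> for the second.\<close>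
  moreover have "?N1 f \<le> ennreal (max 1 K) * ?N2 f" "?N2 f \<le> ennreal (max 1 K) * ?N1 f"
    if f: "f \<in> mfun R" for f
  proof -
    have "1 * ?N2 f \<le> ennreal (max 1 K) * ?N2 f"
      by (intro mult_right_mono) (auto simp flip: ennreal_1 intro!: ennreal_leI)
    then show "?N1 f \<le> ennreal (max 1 K) * ?N2 f" using le[OF f] by simp
    have "ennreal K * ?N1 f \<le> ennreal (max 1 K) * ?N1 f"
      by (intro mult_right_mono ennreal_leI) auto
    then show "?N2 f \<le> ennreal (max 1 K) * ?N1 f" using K(2)[OF f] by simp
  qed
  ultimately show ?thesis
    unfolding spaces_equivalent_def fspace_def by (intro conjI exI[of _ "max 1 K"]) auto
qed

end
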